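(* Let $\Delta\in[0,+\infty)$ and $\rho\in(0,+\infty)$ be fixed, and let $\beta_n$, $\varpi_n$ and $\Psi(\rho,\Delta)=\lim_{n\to\infty}\varpi_n$ be as defined in the context. Then $$\Psi(\rho,\Delta)\le\frac{\pi}{2}.$$ The sequence of functions $\beta_n$ converges to a solution $y_{\rho,\Delta}$ of the boundary value problem $$y_{\rho,\Delta}''(w)+\max\{y_{\rho,\Delta}(w),\ \rho\, r_\Delta(\vartheta_\Delta-w-\Delta)\chi_{[-\Delta,0]}(w)\}=0,\qquad w\in[-\Psi(\rho,\Delta),0],$$ $$y_{\rho,\Delta}(0)=0<y_{\rho,\Delta}(w),\quad w\in[-\Psi(\rho,\Delta),0),$$ $$y_{\rho,\Delta}(w)=1,\quad w\le-\Psi(\rho,\Delta),\qquad y_{\rho,\Delta}'(-\Psi(\rho,\Delta))=0 .$$ Moreover, for any nonnegative function $x$ which satisfies $$x(0)=0,\qquad \max_{t\in[-\Psi(\rho,\Delta),0]}x(t)\le 1,$$ $$x''(w)+\max\Big\{\max_{t\in[w,0]}x(t),\ \rho\, r_\Delta(\vartheta_\Delta-w-\Delta)\chi_{[-\Delta,0]}(w)\Big\}\ge 0,\qquad w\in[-\Psi(\rho,\Delta),0],$$ we have $$y_{\rho,\Delta}(w)\ge x(w),\qquad w\in[-\Psi(\rho,\Delta),0].$$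
   Context: Conventions. Functions whose second derivatives appear in differential equations or inequalities are absolutely continuous together with their first derivative on the interval considered, and the (in)equalities hold almost everywhere. Convergence of $\beta_n$ is pointwise on $(-\infty,0]$. $\chi_S$ is the characteristic function of $S\subset\mathbb{R}$. The function $r_\Delta$ and the number $\vartheta_\Delta$. For $\Delta\ge 0$, $r_\Delta:\mathbb{R}\to\mathbb{R}$ is the solution of $r_\Delta''(t)+r_\Delta(t-\Delta)=0$ for $t\ge 0$, with $r_\Delta(t)=1$ for $t\le 0$ and $r_\Delta'(0)=0$. $\vartheta_\Delta>0$ denotes its first zero (it is known that $r_\Delta$ is strictly decreasing on $[0,\vartheta_\Delta]$ and that $\vartheta_\Delta\geq\sqrt2$ is continuous in $\Delta$; for $\Delta=0$, $r_0=\cos$ on $[0,+\infty)$ and $\vartheta_0=\pi/2$). The sequences. Set $\beta_0(t)\equiv 1$ for $t\le 0$ and, for $n=0,1,2,\dots$, let $\varpi_n\in(0,+\infty)$ be the unique number with $$\int_{-\varpi_n}^{0}\Big[\int_{-\varpi_n}^{u}\max\{\beta_n(v),\rho\, r_\Delta(\vartheta_\Delta-v-\Delta)\chi_{[-\Delta,0]}(v)\}\,dv\Big]du=1,$$ and put $\beta_{n+1}(t)=1$ for $t\le-\varpi_n$ and $$\beta_{n+1}(t)=1-\int_{-\varpi_n}^{t}\Big[\int_{-\varpi_n}^{u}\max\{\beta_n(v),\rho\, r_\Delta(\vartheta_\Delta-v-\Delta)\chi_{[-\Delta,0]}(v)\}\,dv\Big]du,\qquad t\in[-\varpi_n,0].$$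 These sequences are well-defined, $\beta_n$ is pointwise nonincreasing in $n$ and $\varpi_n$ is nondecreasing in $n$; $\Psi(\rho,\Delta):=\lim_{n\to\infty}\varpi_n$. *)

theory Defs
  imports "HOL-Analysis.Analysis"
begin

text \<open>Absolute continuity on a compact interval, with the usual epsilon-delta definition over finite
  families of nonoverlapping subintervals, each given by its pair of endpoints.\<close>

definition abs_continuous_on_interval :: "real \<Rightarrow> real \<Rightarrow> (real \<Rightarrow> real) \<Rightarrow> bool" where
  "abs_continuous_on_interval a b f \<longleftrightarrow>
     (\<forall>\<epsilon>>0. \<exists>\<delta>>0. \<forall>D :: (real \<times> real) set.
        finite D \<and> (\<forall>(c, d)\<in>D. a \<le> c \<and> c < d \<and> d \<le> b) \<and>
        disjoint_family_on (\<lambda>(c, d). {c<..<d}) D \<and> (\<Sum>(c, d)\<in>D. d - c) < \<delta> \<longrightarrow>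
        (\<Sum>(c, d)\<in>D. \<bar>f d - f c\<bar>) < \<epsilon>)"

text \<open>On an unbounded interval absolute continuity is understood locally; on a compact interval this
  is the same as \<^const>\<open>abs_continuous_on_interval\<close>.\<close>

definition abs_continuous_on :: "real set \<Rightarrow> (real \<Rightarrow> real) \<Rightarrow> bool" where
  "abs_continuous_on I f \<longleftrightarrow> (\<forall>a b. {a..b} \<subseteq> I \<longrightarrow> abs_continuous_on_interval a b f)"

text \<open>\<open>f\<close> is absolutely continuous on the interval \<open>I\<close> together with its first derivative
  (one-sided at the end points of \<open>I\<close>), and for almost every \<open>t\<close> in \<open>I\<close> the second derivative
  \<open>f''(t)\<close> exists and satisfies \<open>P t (f''(t))\<close>.\<close>

definition second_deriv_ae :: "real set \<Rightarrow> (real \<Rightarrow> real) \<Rightarrow> (real \<Rightarrow> real \<Rightarrow> bool) \<Rightarrow> bool" where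
  "second_deriv_ae I f P \<longleftrightarrow>
     (\<exists>f'. (\<forall>t\<in>I. (f has_real_derivative f' t) (at t within I)) \<and>
           abs_continuous_on I f \<and> abs_continuous_on I f' \<and>
           (AE t\<in>I in lebesgue. \<exists>d. (f' has_real_derivative d) (at t within I) \<and> P t d))"

definition is_delay_solution :: "real \<Rightarrow> (real \<Rightarrow> real) \<Rightarrow> bool" where
  "is_delay_solution \<Delta> r \<longleftrightarrow>
     second_deriv_ae {0..} r (\<lambda>t d. d + r (t - \<Delta>) = 0) \<and>
     (\<forall>t\<le>0. r t = 1) \<and> (r has_real_derivative 0) (at 0)"

definition delay_cos :: "real \<Rightarrow> real \<Rightarrow> real" where
  "delay_cos \<Delta> = (THE r. is_delay_solution \<Delta> r)"

definition first_zero :: "real \<Rightarrow> real" where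
  "first_zero \<Delta> = (LEAST t. 0 < t \<and> delay_cos \<Delta> t = 0)"

definition forcing :: "real \<Rightarrow> real \<Rightarrow> real \<Rightarrow> real" where
  "forcing \<rho> \<Delta> v = \<rho> * delay_cos \<Delta> (first_zero \<Delta> - v - \<Delta>) * indicator {-\<Delta>..0} v"

definition iterated_integral :: "real \<Rightarrow> real \<Rightarrow> (real \<Rightarrow> real) \<Rightarrow> real \<Rightarrow> real \<Rightarrow> real" where
  "iterated_integral \<rho> \<Delta> b w t =
     integral {-w..t} (\<lambda>u. integral {-w..u} (\<lambda>v. max (b v) (forcing \<rho> \<Delta> v)))"

definition step_width :: "real \<Rightarrow> real \<Rightarrow> (real \<Rightarrow> real) \<Rightarrow> real" where
  "step_width \<rho> \<Delta> b = (THE w. 0 < w \<and> iterated_integral \<rho> \<Delta> b w 0 = 1)"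

text \<open>Only the values of \<open>beta_seq \<rho> \<Delta> n\<close> on the nonpositive half-line are meaningful.\<close>

primrec beta_seq :: "real \<Rightarrow> real \<Rightarrow> nat \<Rightarrow> real \<Rightarrow> real" where
  "beta_seq \<rho> \<Delta> 0 = (\<lambda>t. 1)"
| "beta_seq \<rho> \<Delta> (Suc n) =
     (let b = beta_seq \<rho> \<Delta> n; w = step_width \<rho> \<Delta> b
      in (\<lambda>t. if t \<le> - w then 1 else 1 - iterated_integral \<rho> \<Delta> b w t))"

definition varpi_seq :: "real \<Rightarrow> real \<Rightarrow> nat \<Rightarrow> real" where
  "varpi_seq \<rho> \<Delta> n = step_width \<rho> \<Delta> (beta_seq \<rho> \<Delta> n)"

definition Psi :: "real \<Rightarrow> real \<Rightarrow> real" where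
  "Psi \<rho> \<Delta> = lim (varpi_seq \<rho> \<Delta>)"

text \<open>The boundary value problem on \<open>[-\<Psi>, 0]\<close>. The derivative at \<open>-\<Psi>\<close> is two-sided, since \<open>y\<close> is
  prescribed to the left of that point as well.\<close>

definition solves_bvp :: "real \<Rightarrow> real \<Rightarrow> (real \<Rightarrow> real) \<Rightarrow> bool" where
  "solves_bvp \<rho> \<Delta> y \<longleftrightarrow>
     second_deriv_ae {- Psi \<rho> \<Delta>..0} y (\<lambda>w d. d + max (y w) (forcing \<rho> \<Delta> w) = 0) \<and>
     y 0 = 0 \<and> (\<forall>w\<in>{- Psi \<rho> \<Delta>..<0}. 0 < y w) \<and>
     (\<forall>w\<le>- Psi \<rho> \<Delta>. y w = 1) \<and> (y has_real_derivative 0) (at (- Psi \<rho> \<Delta>))"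

end

theory Submission
  imports Defs
begin

text \<open>Integration by parts rewrites one step of the iteration as integration of
  \<open>max \<beta>\<^sub>n f\<close>, with \<open>f\<close> the forcing term, against the kernel \<open>min (-t) (-v)\<close> over \<open>[-w\<^sub>n, 0]\<close>, where the
  step width \<open>w\<^sub>n\<close> makes the total weighted mass equal to \<open>1\<close>. A single crossing argument shows that a
  larger integrand gives a smaller \<open>w\<close> and a larger function. The integrand \<open>sin (min (-v) (pi / 2))\<close>
  reproduces itself with \<open>w = pi / 2\<close>, so it is a lower barrier for all \<open>\<beta>\<^sub>n\<close>, and
  \<open>w\<^sub>n \<le> pi / 2\<close>. The \<open>\<beta>\<^sub>n\<close> decrease, and dominated convergence passes the integral equation to the
  limit. A subsolution \<open>x\<close> satisfies \<open>x \<le> \<beta>\<^sub>n\<close> for every \<open>n\<close>: since \<open>\<beta>\<^sub>n\<close> is nonincreasing in \<open>t\<close>, it also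
  bounds the running maximum of \<open>x\<close>, hence \<open>\<beta>\<^sub>n\<^sub>+\<^sub>1 - x\<close> is concave on \<open>[-w\<^sub>n, 0]\<close> and nonnegative at
  the end points.

  The forcing is continuous on \<open>(-\<infinity>, 0]\<close> because the delayed cosine vanishes at its first zero.\<close>

section \<open>Absolutely continuous functions\<close>

lemma abs_continuous_on_intervalE:
  assumes "abs_continuous_on_interval a b f" "e > 0"
  obtains \<delta> where "\<delta> > 0"
    "\<And>D. finite D \<Longrightarrow> (\<And>c d. (c, d) \<in> D \<Longrightarrow> a \<le> c \<and> c < d \<and> d \<le> b) \<Longrightarrow>
       disjoint_family_on (\<lambda>(c, d). {c<..<d}) D \<Longrightarrow> (\<Sum>(c, d)\<in>D. d - c) < \<delta> \<Longrightarrow>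
       (\<Sum>(c, d)\<in>D. \<bar>f d - f c\<bar>) < e"
proof -
  from assms(1)[unfolded abs_continuous_on_interval_def, THEN spec, THEN mp, OF assms(2)]
  obtain \<delta> where \<delta>: "\<delta> > 0" and D: "\<forall>D. finite D \<and> (\<forall>(c, d)\<in>D. a \<le> c \<and> c < d \<and> d \<le> b) \<and>
        disjoint_family_on (\<lambda>(c, d). {c<..<d}) D \<and> (\<Sum>(c, d)\<in>D. d - c) < \<delta> \<longrightarrow>
        (\<Sum>(c, d)\<in>D. \<bar>f d - f c\<bar>) < e"
    by (elim exE conjE)
  show thesis
    by (rule that[OF \<delta>], rule D[THEN spec, THEN mp]) auto
qed

text \<open>Outer regularity only controls \<open>G - N\<close>; because \<open>N\<close> is null,
  the same bound holds for \<open>G\<close> itself.\<close>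

lemma null_set_open_cover:
  fixes N :: "'a::euclidean_space set"
  assumes "N \<in> null_sets lebesgue" "\<delta> > 0"
  obtains G where "open G" "N \<subseteq> G" "G \<in> lmeasurable" "measure lebesgue G < \<delta>"
proof -
  have N: "N \<in> sets lebesgue" using assms by auto
  obtain G where G: "open G" "N \<subseteq> G" "emeasure lebesgue (G - N) < ennreal \<delta>"
    using sets_lebesgue_outer_open[OF N \<open>\<delta> > 0\<close>] by metis
  have Gs: "G \<in> sets lebesgue" using \<open>open G\<close> by auto
  have lt: "emeasure lebesgue G < ennreal \<delta>"
    using G(3) by (simp add: emeasure_Diff_null_set[OF assms(1) Gs])
  then have "G \<in> lmeasurable"
    by (intro fmeasurableI Gs) (use less_top order.strict_trans top.not_eq_extremum in fastforce)
  moreover from this lt have "measure lebesgue G < \<delta>"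
    by (simp add: emeasure_eq_measure2 ennreal_less_iff)
  ultimately show thesis using that G by blast
qed

text \<open>A straddle estimate. The difference quotient near \<open>t\<close> stays above
  \<open>- k\<close>, and the two one-sided bounds can be added over a small cell that is split at
  its tag \<open>t\<close>.\<close>

lemma nonneg_deriv_lower_estimate:
  assumes "(f has_real_derivative d) (at t within S)" "d \<ge> 0" "k > 0"
  shows "\<exists>r>0. \<forall>s\<in>S. \<bar>s - t\<bar> < r \<longrightarrow>
    (s \<le> t \<longrightarrow> - k * (t - s) \<le> f t - f s) \<and> (t \<le> s \<longrightarrow> - k * (s - t) \<le> f s - f t)"
proof -
  have "eventually (\<lambda>s. dist ((f s - f t) / (s - t)) d < k) (at t within S)"
    using assms unfolding has_field_derivative_iff by (intro tendstoD)
  then obtain r where "r > 0" and r: "\<And>s. s \<in> S \<Longrightarrow> s \<noteq> t \<Longrightarrow> dist s t < r \<Longrightarrow>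
      dist ((f s - f t) / (s - t)) d < k"
    unfolding eventually_at by blast
  have q: "- k < (f s - f t) / (s - t)" if "s \<in> S" "\<bar>s - t\<bar> < r" "s \<noteq> t" for s
    using r[of s] that \<open>d \<ge> 0\<close> unfolding dist_real_def by linarith
  show ?thesis
  proof (intro exI[of _ r] conjI ballI impI)
    fix s assume s: "s \<in> S" "\<bar>s - t\<bar> < r"
    show "- k * (t - s) \<le> f t - f s" if "s \<le> t"
    proof (cases "s = t")
      case False
      then show ?thesis using q[OF s False] that by (simp add: field_simps)
    qed simp
    show "- k * (s - t) \<le> f s - f t" if "t \<le> s"
    proof (cases "s = t")
      case False
      then show ?thesis using q[OF s False] that by (simp add: field_simps)
    qed simp
  qed (rule \<open>r > 0\<close>)
qed

lemma tagged_division_of_interval_form: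
  fixes p :: "(real \<times> real set) set"
  assumes "p tagged_division_of {a..b}" "(x, K) \<in> p"
  shows "K = {Inf K..Sup K}" "Inf K \<le> x" "x \<le> Sup K" "a \<le> Inf K" "Sup K \<le> b"
proof -
  obtain c d where K: "K = {c..d}" using tagged_division_ofD(4)[OF assms] by auto
  have "x \<in> K" "K \<subseteq> {a..b}" using tagged_division_ofD(2,3)[OF assms] by auto
  then show "K = {Inf K..Sup K}" "Inf K \<le> x" "x \<le> Sup K" "a \<le> Inf K" "Sup K \<le> b"
    using K by auto
qed

text \<open>Translates tagged cells into the endpoint pairs of which absolute continuity speaks.
  Degenerate cells contribute nothing and are dropped, since the pairs must satisfy
  \<open>c < d\<close>. For the others, the interiors are nonempty and disjoint, so no two cells
  share their endpoints.\<close>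

lemma sum_over_small_tagged_cells:
  fixes f :: "real \<Rightarrow> real"
  assumes p: "p tagged_division_of {a..b}" and "B \<subseteq> p"
    and G: "G \<in> lmeasurable" "measure lebesgue G < \<delta>" "\<And>x K. (x, K) \<in> B \<Longrightarrow> K \<subseteq> G"
    and \<delta>: "\<And>D. finite D \<Longrightarrow> (\<And>c d. (c, d) \<in> D \<Longrightarrow> a \<le> c \<and> c < d \<and> d \<le> b) \<Longrightarrow>
       disjoint_family_on (\<lambda>(c, d). {c<..<d}) D \<Longrightarrow> (\<Sum>(c, d)\<in>D. d - c) < \<delta> \<Longrightarrow>
       (\<Sum>(c, d)\<in>D. \<bar>f d - f c\<bar>) < e"
  shows "(\<Sum>(x, K)\<in>B. \<bar>f (Sup K) - f (Inf K)\<bar>) < e"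
proof -
  note form = tagged_division_of_interval_form[OF p]
  define B' where "B' = {xK \<in> B. Inf (snd xK) < Sup (snd xK)}"
  define \<phi> where "\<phi> = (\<lambda>xK::real \<times> real set. (Inf (snd xK), Sup (snd xK)))"
  have "finite p" using p by auto
  then have fin: "finite B" "finite B'"
    using \<open>B \<subseteq> p\<close> by (auto simp: B'_def intro: finite_subset)
  have B'D: "(x, K) \<in> p" "(x, K) \<in> B" "Inf K < Sup K" if "(x, K) \<in> B'" for x K
    using that \<open>B \<subseteq> p\<close> by (auto simp: B'_def)
  have disj: "{Inf K<..<Sup K} \<inter> {Inf L<..<Sup L} = {}"
    if "(x, K) \<in> p" "(y, L) \<in> p" "(x, K) \<noteq> (y, L)" for x K y L
  proof -
    have "interior K \<inter> interior L = {}" using tagged_division_ofD(5)[OF p that] .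
    moreover have "interior K = {Inf K<..<Sup K}" "interior L = {Inf L<..<Sup L}"
      using form(1)[OF that(1)] form(1)[OF that(2)] by (metis interior_atLeastAtMost_real)+
    ultimately show ?thesis by simp
  qed
  have inj: "inj_on \<phi> B'"
  proof (rule inj_onI, clarify)
    fix x K y L assume xy: "(x, K) \<in> B'" "(y, L) \<in> B'" "\<phi> (x, K) = \<phi> (y, L)"
    show "x = y \<and> K = L"
    proof (rule ccontr)
      assume "\<not> (x = y \<and> K = L)"
      then have "{Inf K<..<Sup K} \<inter> {Inf L<..<Sup L} = {}"
        using disj[OF B'D(1)[OF xy(1)] B'D(1)[OF xy(2)]] by blast
      then have "{Inf K<..<Sup K} = {}" using xy(3) by (simp add: \<phi>_def)
      then show False using B'D(3)[OF xy(1)] by simp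
    qed
  qed
  have D: "disjoint_family_on (\<lambda>(c, d). {c<..<d}) (\<phi> ` B')"
    unfolding disjoint_family_on_def
  proof (intro ballI impI)
    fix u v assume "u \<in> \<phi> ` B'" "v \<in> \<phi> ` B'" "u \<noteq> v"
    then obtain x K y L where xy: "(x, K) \<in> B'" "(y, L) \<in> B'" "u = \<phi> (x, K)" "v = \<phi> (y, L)"
      by fastforce
    then have "(x, K) \<noteq> (y, L)" using \<open>u \<noteq> v\<close> by blast
    then show "(case u of (c, d) \<Rightarrow> {c<..<d}) \<inter> (case v of (c, d) \<Rightarrow> {c<..<d}) = {}"
      using disj[OF B'D(1)[OF xy(1)] B'D(1)[OF xy(2)]] xy by (simp add: \<phi>_def)
  qed
  have ends: "a \<le> c \<and> c < d \<and> d \<le> b \<and> {c<..<d} \<subseteq> G" if cd: "(c, d) \<in> \<phi> ` B'" for c d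
  proof -
    obtain x K where K: "(x, K) \<in> B'" "c = Inf K" "d = Sup K"
      using cd by (auto simp: \<phi>_def)
    have "{c<..<d} \<subseteq> {c..d}" by auto
    also have "\<dots> \<subseteq> G" using form(1)[OF B'D(1)[OF K(1)]] G(3)[OF B'D(2)[OF K(1)]] K by simp
    finally show ?thesis using form(4,5)[OF B'D(1)[OF K(1)]] B'D(3)[OF K(1)] K by simp
  qed
  \<comment> \<open>The total length is the measure of a disjoint union of open intervals inside
    \<open>G\<close>, hence below \<open>\<delta>\<close>.\<close>
  have "(\<Sum>(c, d)\<in>\<phi> ` B'. d - c) = (\<Sum>I\<in>\<phi> ` B'. measure lebesgue ((\<lambda>(c, d). {c<..<d}) I))"
    by (rule sum.cong[OF refl]) (use ends in \<open>force simp: less_imp_le\<close>)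
  also have "\<dots> = measure lebesgue (\<Union>I\<in>\<phi> ` B'. (\<lambda>(c, d). {c<..<d}) I)"
  proof (rule measure_finite_Union[symmetric])
    show "emeasure lebesgue (case I of (c, d) \<Rightarrow> {c<..<d}) \<noteq> \<infinity>" if "I \<in> \<phi> ` B'" for I
      using that ends[of "fst I" "snd I"] by (cases I) auto
  qed (use fin D in auto)
  also have "\<dots> \<le> measure lebesgue G"
  proof (rule measure_mono_fmeasurable)
    show "(\<Union>I\<in>\<phi> ` B'. (\<lambda>(c, d). {c<..<d}) I) \<subseteq> G"
    proof (rule UN_least)
      fix I assume "I \<in> \<phi> ` B'"
      then show "(\<lambda>(c, d). {c<..<d}) I \<subseteq> G" using ends[of "fst I" "snd I"] by (cases I) simp
    qed
    show "(\<Union>I\<in>\<phi> ` B'. (\<lambda>(c, d). {c<..<d}) I) \<in> sets lebesgue"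
      using fin by (intro sets.finite_UN) auto
  qed (rule G)
  finally have "(\<Sum>(c, d)\<in>\<phi> ` B'. d - c) < \<delta>" using G by simp
  then have "(\<Sum>(c, d)\<in>\<phi> ` B'. \<bar>f d - f c\<bar>) < e"
    using ends fin D by (intro \<delta>) auto
  moreover have "(\<Sum>(c, d)\<in>\<phi> ` B'. \<bar>f d - f c\<bar>) = (\<Sum>(x, K)\<in>B'. \<bar>f (Sup K) - f (Inf K)\<bar>)"
    unfolding sum.reindex[OF inj] by (simp add: \<phi>_def case_prod_unfold)
  moreover have "(\<Sum>(x, K)\<in>B. \<bar>f (Sup K) - f (Inf K)\<bar>) = (\<Sum>(x, K)\<in>B'. \<bar>f (Sup K) - f (Inf K)\<bar>)"
  proof (rule sum.mono_neutral_right)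
    show "\<forall>i\<in>B - B'. (case i of (x, K) \<Rightarrow> \<bar>f (Sup K) - f (Inf K)\<bar>) = 0"
    proof clarify
      fix x K assume "(x, K) \<in> B" "(x, K) \<notin> B'"
      then have "Sup K \<le> Inf K" "(x, K) \<in> p" using \<open>B \<subseteq> p\<close> by (auto simp: B'_def)
      then have "Sup K = Inf K" using form(2,3)[of x K] by simp
      then show "\<bar>f (Sup K) - f (Inf K)\<bar> = 0" by simp
    qed
  qed (use fin in \<open>auto simp: B'_def\<close>)
  ultimately show ?thesis by simp
qed

text \<open>Take a division fine for a gauge that puts cells tagged in the exceptional null set into an open
  set of small measure, where absolute continuity applies, and controls the others by the derivative.\<close>

lemma abs_continuous_nonneg_deriv_AE_le:
  assumes ac: "abs_continuous_on_interval a b f" and "a \<le> b"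
    and deriv: "AE t\<in>{a..b} in lebesgue. \<exists>d\<ge>0. (f has_real_derivative d) (at t within {a..b})"
  shows "f a \<le> f b"
proof (rule field_le_epsilon)
  fix e :: real
  assume "e > 0"
  then have "e / 2 > 0" by simp
  then obtain \<delta> where "\<delta> > 0" and \<delta>:
    "\<And>D. finite D \<Longrightarrow> (\<And>c d. (c, d) \<in> D \<Longrightarrow> a \<le> c \<and> c < d \<and> d \<le> b) \<Longrightarrow>
       disjoint_family_on (\<lambda>(c, d). {c<..<d}) D \<Longrightarrow> (\<Sum>(c, d)\<in>D. d - c) < \<delta> \<Longrightarrow>
       (\<Sum>(c, d)\<in>D. \<bar>f d - f c\<bar>) < e / 2"
    using abs_continuous_on_intervalE[OF ac] by blast
  \<comment> \<open>The slope error allowed on good cells: summed over a total length of at most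
    \<open>b - a\<close> it costs at most \<open>e / 2\<close>. The added 1 keeps the denominator
    positive when \<open>a = b\<close>.\<close>
  define k where "k = e / (2 * (b - a + 1))"
  have "k > 0" using \<open>e > 0\<close> \<open>a \<le> b\<close> by (simp add: k_def)
  have kba: "k * (b - a) \<le> e / 2"
  proof -
    have "(b - a) / (b - a + 1) \<le> 1" using \<open>a \<le> b\<close> by simp
    then have "e / 2 * ((b - a) / (b - a + 1)) \<le> e / 2 * 1"
      using \<open>e > 0\<close> by (intro mult_left_mono) auto
    then show ?thesis by (simp add: k_def field_simps)
  qed
  obtain N where N: "N \<in> null_sets lebesgue" and sub: "{t \<in> space lebesgue.
      \<not> (t \<in> {a..b} \<longrightarrow> (\<exists>d\<ge>0. (f has_real_derivative d) (at t within {a..b})))} \<subseteq> N"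
    using deriv unfolding eventually_ae_filter by blast
  have good: "\<exists>d\<ge>0. (f has_real_derivative d) (at t within {a..b})" if "t \<in> {a..b}" "t \<notin> N" for t
    using sub that by (simp add: subset_iff del: atLeastAtMost_iff) blast
  obtain G where G: "open G" "N \<subseteq> G" "G \<in> lmeasurable" "measure lebesgue G < \<delta>"
    using null_set_open_cover[OF N \<open>\<delta> > 0\<close>] .
  have "\<forall>t\<in>{a..b} - N. \<exists>r>0. \<forall>s\<in>{a..b}. \<bar>s - t\<bar> < r \<longrightarrow>
    (s \<le> t \<longrightarrow> - k * (t - s) \<le> f t - f s) \<and> (t \<le> s \<longrightarrow> - k * (s - t) \<le> f s - f t)"
  proof
    fix t assume "t \<in> {a..b} - N"
    then obtain d where "d \<ge> 0" "(f has_real_derivative d) (at t within {a..b})"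
      using good[of t] by (metis DiffE)
    then show "\<exists>r>0. \<forall>s\<in>{a..b}. \<bar>s - t\<bar> < r \<longrightarrow>
        (s \<le> t \<longrightarrow> - k * (t - s) \<le> f t - f s) \<and> (t \<le> s \<longrightarrow> - k * (s - t) \<le> f s - f t)"
      using \<open>k > 0\<close> by (intro nonneg_deriv_lower_estimate)
  qed
  from bchoice[OF this] obtain r where r: "\<forall>t\<in>{a..b} - N. r t > 0 \<and> (\<forall>s\<in>{a..b}. \<bar>s - t\<bar> < r t \<longrightarrow>
    (s \<le> t \<longrightarrow> - k * (t - s) \<le> f t - f s) \<and> (t \<le> s \<longrightarrow> - k * (s - t) \<le> f s - f t))"
    by (rule exE)
  define g where "g t = (if t \<in> N then G else if t \<in> {a..b} then ball t (r t) else UNIV)" for t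
  have "gauge g"
    unfolding gauge_def g_def using \<open>open G\<close> \<open>N \<subseteq> G\<close> r by auto
  then obtain p where p: "p tagged_division_of {a..b}" and fine: "g fine p"
    by (rule fine_division_exists_real)
  note form = tagged_division_of_interval_form[OF p]
  have finp: "finite p" using p by auto
  define B where "B = {xK \<in> p. fst xK \<in> N}"
  have "B \<subseteq> p" by (auto simp: B_def)
  have "K \<subseteq> G" if "(x, K) \<in> B" for x K
  proof -
    have "(x, K) \<in> p" "g x = G" using that by (auto simp: B_def g_def)
    then show ?thesis using fine unfolding fine_def by blast
  qed
  then have "(\<Sum>(x, K)\<in>B. \<bar>f (Sup K) - f (Inf K)\<bar>) < e / 2"
    using sum_over_small_tagged_cells[OF p \<open>B \<subseteq> p\<close> G(3,4)] \<delta> by blast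
  moreover have "- (\<Sum>(x, K)\<in>B. \<bar>f (Sup K) - f (Inf K)\<bar>) \<le> (\<Sum>(x, K)\<in>B. f (Sup K) - f (Inf K))"
    unfolding sum_negf[symmetric] by (rule sum_mono) auto
  ultimately have bad: "- (e / 2) \<le> (\<Sum>(x, K)\<in>B. f (Sup K) - f (Inf K))" by linarith
  have "(\<Sum>(x, K)\<in>p - B. Sup K - Inf K) \<le> (\<Sum>(x, K)\<in>p. Sup K - Inf K)"
  proof (rule sum_mono2)
    show "0 \<le> (case xK of (x, K) \<Rightarrow> Sup K - Inf K)" if "xK \<in> p - (p - B)" for xK
      using that form(2,3)[of "fst xK" "snd xK"] by (cases xK) auto
  qed (use finp in auto)
  also have "\<dots> = b - a"
    using additive_tagged_division_1[OF \<open>a \<le> b\<close> p, of "\<lambda>x. x"] by simp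
  finally have "- (k * (b - a)) \<le> - k * (\<Sum>(x, K)\<in>p - B. Sup K - Inf K)"
    using \<open>k > 0\<close> by simp
  also have "\<dots> = (\<Sum>(x, K)\<in>p - B. - k * (Sup K - Inf K))"
    by (simp add: sum_distrib_left case_prod_unfold)
  also have "\<dots> \<le> (\<Sum>(x, K)\<in>p - B. f (Sup K) - f (Inf K))"
  proof (rule sum_mono, clarify)
    fix x K assume xK: "(x, K) \<in> p" "(x, K) \<notin> B"
    then have "x \<notin> N" by (simp add: B_def)
    have x: "x \<in> {a..b}" using form[OF xK(1)] by auto
    have "g x = ball x (r x)" using x \<open>x \<notin> N\<close> by (simp add: g_def)
    then have "K \<subseteq> ball x (r x)" using fine xK unfolding fine_def by blast
    moreover have "Inf K \<in> K" "Sup K \<in> K"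
      using form[OF xK(1)] by (metis atLeastAtMost_iff order_refl order_trans)+
    ultimately have "\<bar>Inf K - x\<bar> < r x" "\<bar>Sup K - x\<bar> < r x"
      by (auto simp: dist_real_def abs_minus_commute)
    moreover have "Inf K \<in> {a..b}" "Sup K \<in> {a..b}" using form[OF xK(1)] by auto
    ultimately have "- k * (x - Inf K) \<le> f x - f (Inf K)" "- k * (Sup K - x) \<le> f (Sup K) - f x"
      using r x \<open>x \<notin> N\<close> form(2,3)[OF xK(1)] by (metis DiffI)+
    then show "- k * (Sup K - Inf K) \<le> f (Sup K) - f (Inf K)" by (simp add: algebra_simps)
  qed
  finally have "- (e / 2) \<le> (\<Sum>(x, K)\<in>p - B. f (Sup K) - f (Inf K))" using kba by linarith
  moreover have "f b - f a = (\<Sum>(x, K)\<in>p - B. f (Sup K) - f (Inf K)) + (\<Sum>(x, K)\<in>B. f (Sup K) - f (Inf K))"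
    unfolding additive_tagged_division_1[OF \<open>a \<le> b\<close> p, symmetric]
    by (rule sum.subset_diff[OF \<open>B \<subseteq> p\<close> finp])
  ultimately show "f a \<le> f b + e" using bad by linarith
qed

section \<open>Closure rules, a Lipschitz criterion and derivative bounds for absolute
  continuity\<close>

lemma abs_continuous_on_interval_add:
  assumes "abs_continuous_on_interval a b f" "abs_continuous_on_interval a b g"
  shows "abs_continuous_on_interval a b (\<lambda>t. f t + g t)"
  unfolding abs_continuous_on_interval_def
proof (intro allI impI)
  fix e :: real assume "e > 0"
  then have "e / 2 > 0" by simp
  obtain \<delta>1 where "\<delta>1 > 0" and 1:
    "\<And>D. finite D \<Longrightarrow> (\<And>c d. (c, d) \<in> D \<Longrightarrow> a \<le> c \<and> c < d \<and> d \<le> b) \<Longrightarrow>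
       disjoint_family_on (\<lambda>(c, d). {c<..<d}) D \<Longrightarrow> (\<Sum>(c, d)\<in>D. d - c) < \<delta>1 \<Longrightarrow>
       (\<Sum>(c, d)\<in>D. \<bar>f d - f c\<bar>) < e / 2"
    using abs_continuous_on_intervalE[OF assms(1) \<open>e / 2 > 0\<close>] by blast
  obtain \<delta>2 where "\<delta>2 > 0" and 2:
    "\<And>D. finite D \<Longrightarrow> (\<And>c d. (c, d) \<in> D \<Longrightarrow> a \<le> c \<and> c < d \<and> d \<le> b) \<Longrightarrow>
       disjoint_family_on (\<lambda>(c, d). {c<..<d}) D \<Longrightarrow> (\<Sum>(c, d)\<in>D. d - c) < \<delta>2 \<Longrightarrow>
       (\<Sum>(c, d)\<in>D. \<bar>g d - g c\<bar>) < e / 2"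
    using abs_continuous_on_intervalE[OF assms(2) \<open>e / 2 > 0\<close>] by blast
  have "(\<Sum>(c, d)\<in>D. \<bar>f d + g d - (f c + g c)\<bar>) < e"
    if D: "finite D" "\<forall>(c, d)\<in>D. a \<le> c \<and> c < d \<and> d \<le> b"
      "disjoint_family_on (\<lambda>(c, d). {c<..<d}) D" "(\<Sum>(c, d)\<in>D. d - c) < min \<delta>1 \<delta>2" for D
  proof -
    have "(\<Sum>(c, d)\<in>D. \<bar>f d + g d - (f c + g c)\<bar>) \<le> (\<Sum>(c, d)\<in>D. \<bar>f d - f c\<bar>) + (\<Sum>(c, d)\<in>D. \<bar>g d - g c\<bar>)"
      unfolding sum.distrib[symmetric] by (rule sum_mono) auto
    moreover have "(\<Sum>(c, d)\<in>D. \<bar>f d - f c\<bar>) < e / 2" by (rule 1) (use D in auto)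
    moreover have "(\<Sum>(c, d)\<in>D. \<bar>g d - g c\<bar>) < e / 2" by (rule 2) (use D in auto)
    ultimately show ?thesis by simp
  qed
  then show "\<exists>\<delta>>0. \<forall>D. finite D \<and> (\<forall>(c, d)\<in>D. a \<le> c \<and> c < d \<and> d \<le> b) \<and>
        disjoint_family_on (\<lambda>(c, d). {c<..<d}) D \<and> (\<Sum>(c, d)\<in>D. d - c) < \<delta> \<longrightarrow>
        (\<Sum>(c, d)\<in>D. \<bar>f d + g d - (f c + g c)\<bar>) < e"
    using \<open>\<delta>1 > 0\<close> \<open>\<delta>2 > 0\<close> by (intro exI[of _ "min \<delta>1 \<delta>2"]) auto
qed

lemma abs_continuous_on_interval_uminus:
  "abs_continuous_on_interval a b f \<Longrightarrow> abs_continuous_on_interval a b (\<lambda>t. - f t)"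
  unfolding abs_continuous_on_interval_def by (simp add: abs_minus_commute)

lemma abs_continuous_on_add:
  "abs_continuous_on I f \<Longrightarrow> abs_continuous_on I g \<Longrightarrow> abs_continuous_on I (\<lambda>t. f t + g t)"
  unfolding abs_continuous_on_def by (simp add: abs_continuous_on_interval_add)

lemma abs_continuous_on_uminus:
  "abs_continuous_on I f \<Longrightarrow> abs_continuous_on I (\<lambda>t. - f t)"
  unfolding abs_continuous_on_def by (simp add: abs_continuous_on_interval_uminus)

lemma abs_continuous_on_interval_lipschitz:
  assumes "\<And>s t. a \<le> s \<Longrightarrow> s \<le> t \<Longrightarrow> t \<le> b \<Longrightarrow> \<bar>f t - f s\<bar> \<le> L * (t - s)"
  shows "abs_continuous_on_interval a b f"
  unfolding abs_continuous_on_interval_def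
proof (intro allI impI)
  fix e :: real assume "e > 0"
  \<comment> \<open>Strictly positive whatever the sign of \<open>L\<close>, so that
    \<open>e / M\<close> can serve as the threshold.\<close>
  define M where "M = \<bar>L\<bar> + 1"
  have "M > 0" by (simp add: M_def)
  have "(\<Sum>(c, d)\<in>D. \<bar>f d - f c\<bar>) < e"
    if D: "finite D" "\<forall>(c, d)\<in>D. a \<le> c \<and> c < d \<and> d \<le> b" "(\<Sum>(c, d)\<in>D. d - c) < e / M" for D
  proof -
    have "(\<Sum>(c, d)\<in>D. \<bar>f d - f c\<bar>) \<le> (\<Sum>(c, d)\<in>D. M * (d - c))"
    proof (rule sum_mono, clarify)
      fix c d assume "(c, d) \<in> D"
      then have "a \<le> c" "c < d" "d \<le> b" using D by auto
      then have "\<bar>f d - f c\<bar> \<le> L * (d - c)" using assms by simp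
      also have "\<dots> \<le> M * (d - c)" using \<open>c < d\<close> by (intro mult_right_mono) (auto simp: M_def)
      finally show "\<bar>f d - f c\<bar> \<le> M * (d - c)" .
    qed
    also have "\<dots> = M * (\<Sum>(c, d)\<in>D. d - c)" by (simp add: sum_distrib_left case_prod_unfold)
    also have "\<dots> < e" using D(3) \<open>M > 0\<close> by (simp add: field_simps)
    finally show ?thesis .
  qed
  then show "\<exists>\<delta>>0. \<forall>D. finite D \<and> (\<forall>(c, d)\<in>D. a \<le> c \<and> c < d \<and> d \<le> b) \<and>
        disjoint_family_on (\<lambda>(c, d). {c<..<d}) D \<and> (\<Sum>(c, d)\<in>D. d - c) < \<delta> \<longrightarrow>
        (\<Sum>(c, d)\<in>D. \<bar>f d - f c\<bar>) < e"
    using \<open>e > 0\<close> \<open>M > 0\<close> by (intro exI[of _ "e / M"]) auto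
qed

lemma mvt_within_real:
  fixes f :: "real \<Rightarrow> real"
  assumes "a < b" "{a..b} \<subseteq> I" "\<And>t. t \<in> I \<Longrightarrow> (f has_real_derivative f' t) (at t within I)"
  obtains \<xi> where "a < \<xi>" "\<xi> < b" "f b - f a = f' \<xi> * (b - a)"
proof -
  have d: "(f has_real_derivative f' t) (at t within {a..b})" if "t \<in> {a..b}" for t
    using assms(2) assms(3)[of t] that DERIV_subset by blast
  have "\<exists>x\<in>{a<..<b}. f b - f a = (\<lambda>v. f' x * v) (b - a)"
  proof (rule mvt_simple[OF \<open>a < b\<close>])
    fix x assume "a \<le> x" "x \<le> b"
    then show "(f has_derivative (*) (f' x)) (at x within {a..b})"
      using d[of x] by (simp add: has_field_derivative_def)
  qed
  then show thesis using that by auto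
qed

text \<open>On each compact subinterval the continuous derivative is bounded, so the mean value
  theorem makes \<open>f\<close> Lipschitz there.\<close>

lemma abs_continuous_on_C1:
  assumes "\<And>t. t \<in> I \<Longrightarrow> (f has_real_derivative f' t) (at t within I)" "continuous_on I f'"
  shows "abs_continuous_on I f"
  unfolding abs_continuous_on_def
proof (intro allI impI)
  fix a b assume ab: "{a..b} \<subseteq> I"
  have "compact (f' ` {a..b})"
    using assms(2) ab by (intro compact_continuous_image) (auto intro: continuous_on_subset)
  then have "bounded (f' ` {a..b})" by (rule compact_imp_bounded)
  then obtain L where "\<forall>x\<in>f' ` {a..b}. norm x \<le> L"
    unfolding bounded_iff by blast
  then have L: "\<bar>f' t\<bar> \<le> L" if "t \<in> {a..b}" for t
    using that by force
  show "abs_continuous_on_interval a b f"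
  proof (rule abs_continuous_on_interval_lipschitz[where L=L])
    fix s t assume st: "a \<le> s" "s \<le> t" "t \<le> b"
    show "\<bar>f t - f s\<bar> \<le> L * (t - s)"
    proof (cases "s = t")
      case False
      then have "s < t" using st by simp
      moreover have "{s..t} \<subseteq> I" using st ab by auto
      ultimately obtain \<xi> where \<xi>: "s < \<xi>" "\<xi> < t" "f t - f s = f' \<xi> * (t - s)"
        using mvt_within_real assms(1) by blast
      then have "\<bar>f t - f s\<bar> = \<bar>f' \<xi>\<bar> * (t - s)" by (simp add: abs_mult)
      also have "\<dots> \<le> L * (t - s)" using L[of \<xi>] \<xi> st by (intro mult_right_mono) auto
      finally show ?thesis .
    qed simp
  qed
qed

text \<open>A mean value inequality: \<open>M * t + f t\<close> and \<open>M * t - f t\<close> both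
  have a nonnegative derivative almost everywhere, so neither decreases from \<open>a\<close> to
  \<open>b\<close>.\<close>

lemma abs_continuous_deriv_bound_AE:
  assumes ac: "abs_continuous_on_interval a b f" and "a \<le> b"
    and deriv: "AE t\<in>{a..b} in lebesgue. \<exists>d. \<bar>d\<bar> \<le> M \<and> (f has_real_derivative d) (at t within {a..b})"
  shows "\<bar>f b - f a\<bar> \<le> M * (b - a)"
proof -
  have lin: "abs_continuous_on_interval a b (\<lambda>t. M * t)"
    by (rule abs_continuous_on_interval_lipschitz[where L="\<bar>M\<bar>"])
      (simp add: right_diff_distrib[symmetric] abs_mult)
  have le: "M * a + g a \<le> M * b + g b" if g: "abs_continuous_on_interval a b g"
    "AE t\<in>{a..b} in lebesgue. \<exists>d. \<bar>d\<bar> \<le> M \<and> (g has_real_derivative d) (at t within {a..b})" for g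
  proof (rule abs_continuous_nonneg_deriv_AE_le[OF _ \<open>a \<le> b\<close>])
    show "abs_continuous_on_interval a b (\<lambda>t. M * t + g t)"
      by (intro abs_continuous_on_interval_add lin g)
    show "AE t\<in>{a..b} in lebesgue. \<exists>d\<ge>0. ((\<lambda>t. M * t + g t) has_real_derivative d) (at t within {a..b})"
      using g(2)
    proof (rule AE_mp, intro AE_I2 impI)
      fix t assume "t \<in> {a..b} \<longrightarrow> (\<exists>d. \<bar>d\<bar> \<le> M \<and> (g has_real_derivative d) (at t within {a..b}))" "t \<in> {a..b}"
      then obtain d where d: "\<bar>d\<bar> \<le> M" "(g has_real_derivative d) (at t within {a..b})" by blast
      have "((\<lambda>t. M * t + g t) has_real_derivative M + d) (at t within {a..b})"
        using d(2) by (auto intro!: derivative_eq_intros)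
      then show "\<exists>d\<ge>0. ((\<lambda>t. M * t + g t) has_real_derivative d) (at t within {a..b})"
        using d(1) by (intro exI[of _ "M + d"]) auto
    qed
  qed
  have "AE t\<in>{a..b} in lebesgue. \<exists>d. \<bar>d\<bar> \<le> M \<and> ((\<lambda>t. - f t) has_real_derivative d) (at t within {a..b})"
    using deriv by (rule AE_mp, intro AE_I2 impI) (metis DERIV_minus abs_minus_cancel)
  then have "M * a + - f a \<le> M * b + - f b"
    by (intro le abs_continuous_on_interval_uminus ac)
  moreover have "M * a + f a \<le> M * b + f b" by (rule le[OF ac deriv])
  ultimately show ?thesis by (simp add: algebra_simps abs_le_iff)
qed


lemma has_real_derivative_within_interval_unique:
  fixes f :: "real \<Rightarrow> real"
  assumes "(f has_real_derivative D) (at x within S)" "(f has_real_derivative E) (at x within S)"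
    "{a..b} \<subseteq> S" "x \<in> {a..b}" "a < b"
  shows "D = E"
proof -
  have "(f has_vector_derivative D) (at x within {a..b})" "(f has_vector_derivative E) (at x within {a..b})"
    using assms(1-3) unfolding has_real_derivative_iff_has_vector_derivative
    by (meson has_vector_derivative_within_subset)+
  then show ?thesis
    using vector_derivative_unique_within_closed_interval[of a b x f D E] assms(4,5) by auto
qed

section \<open>The delayed cosine\<close>

text \<open>A contraction over length 1/2, with \<open>d\<close> the difference of two solutions and
  \<open>e\<close> its derivative. If \<open>M\<close> is the maximum of
  \<open>\<bar>d\<bar>\<close> on the new piece, then
  \<open>\<bar>e t\<bar> \<le> M * (t - a)\<close>, and a second integration gives
  \<open>M \<le> M / 4\<close>. The step length does not depend on \<Delta>, so \<Delta> = 0 is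
  covered too, where stepping by the delay would make no progress.\<close>

lemma delay_difference_vanishes_step:
  fixes d e :: "real \<Rightarrow> real"
  assumes "\<Delta> \<ge> 0" "a \<ge> 0" and zero: "\<And>t. t \<le> a \<Longrightarrow> d t = 0" and "e a = 0"
    and d: "\<And>t. t \<ge> 0 \<Longrightarrow> (d has_real_derivative e t) (at t within {0..})"
    and ac: "abs_continuous_on {0..} e"
    and e: "AE t\<in>{0..} in lebesgue. (e has_real_derivative - d (t - \<Delta>)) (at t within {0..})"
  shows "(\<forall>t\<le>a + 1 / 2. d t = 0) \<and> e (a + 1 / 2) = 0"
proof -
  have sub: "{a..b} \<subseteq> {0..}" for b using \<open>a \<ge> 0\<close> by auto
  have "continuous_on {a..a + 1/2} d"
    using DERIV_continuous_on[of "{0..}" d e] d by (auto intro: continuous_on_subset[OF _ sub])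
  then obtain m where m: "m \<in> {a..a + 1/2}" "\<And>t. t \<in> {a..a + 1/2} \<Longrightarrow> \<bar>d t\<bar> \<le> \<bar>d m\<bar>"
    using continuous_attains_sup[of "{a..a + 1/2}" "\<lambda>t. \<bar>d t\<bar>"]
    by (auto intro!: continuous_on_rabs simp del: atLeastAtMost_iff)
  define M where "M = \<bar>d m\<bar>"
  have dM: "\<bar>d t\<bar> \<le> M" if "t \<le> a + 1/2" for t
    using m(2)[of t] zero[of t] that by (cases "t \<le> a") (auto simp: M_def)
  have eM: "\<bar>e t\<bar> \<le> M * (t - a)" if t: "t \<in> {a..a + 1/2}" for t
  proof -
    have "\<bar>e t - e a\<bar> \<le> M * (t - a)"
    proof (rule abs_continuous_deriv_bound_AE)
      show "abs_continuous_on_interval a t e" using ac sub unfolding abs_continuous_on_def by blast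
      show "AE s\<in>{a..t} in lebesgue. \<exists>c. \<bar>c\<bar> \<le> M \<and> (e has_real_derivative c) (at s within {a..t})"
        using e
      proof (rule AE_mp, intro AE_I2 impI)
        fix s assume s: "s \<in> {0..} \<longrightarrow> (e has_real_derivative - d (s - \<Delta>)) (at s within {0..})" "s \<in> {a..t}"
        then have "(e has_real_derivative - d (s - \<Delta>)) (at s within {a..t})"
          using sub by (meson DERIV_subset subsetD)
        moreover have "\<bar>- d (s - \<Delta>)\<bar> \<le> M" using dM[of "s - \<Delta>"] s(2) t \<open>\<Delta> \<ge> 0\<close> by simp
        ultimately show "\<exists>c. \<bar>c\<bar> \<le> M \<and> (e has_real_derivative c) (at s within {a..t})" by blast
      qed
    qed (use t in auto)
    then show ?thesis using \<open>e a = 0\<close> by simp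
  qed
  have "M \<le> M / 4"
  proof (cases "m = a")
    case True
    then show ?thesis using zero by (simp add: M_def)
  next
    case False
    then have "a < m" using m by auto
    then obtain \<xi> where \<xi>: "a < \<xi>" "\<xi> < m" "d m - d a = e \<xi> * (m - a)"
      using mvt_within_real[OF _ sub] d by (metis atLeast_iff)
    have "\<bar>e \<xi>\<bar> \<le> M * (\<xi> - a)" using eM[of \<xi>] \<xi> m by auto
    also have "\<dots> \<le> M * (1/2)" using \<xi> m by (intro mult_left_mono) (auto simp: M_def)
    finally have "\<bar>e \<xi>\<bar> * (m - a) \<le> M * (1/2) * (1/2)" using \<open>a < m\<close> m by (intro mult_mono) (auto simp: M_def)
    moreover have "M = \<bar>e \<xi>\<bar> * (m - a)" using \<xi> zero[of a] \<open>a < m\<close> by (simp add: M_def abs_mult)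
    ultimately show ?thesis by simp
  qed
  moreover have "M \<ge> 0" by (simp add: M_def)
  ultimately have "M = 0" by simp
  then show ?thesis using dM eM[of "a + 1/2"] by auto
qed

text \<open>Two solutions agree on the nonpositive half-line and have the same slope at 0; steps of
  length 1/2 carry the agreement to every \<open>t\<close>.\<close>

lemma is_delay_solution_unique:
  assumes "\<Delta> \<ge> 0" and r: "is_delay_solution \<Delta> r" and q: "is_delay_solution \<Delta> q"
  shows "r = q"
proof -
  have ex: "\<exists>f'. (\<forall>t\<ge>0. (f has_real_derivative f' t) (at t within {0..})) \<and> abs_continuous_on {0..} f' \<and>
      (AE t\<in>{0..} in lebesgue. (f' has_real_derivative - f (t - \<Delta>)) (at t within {0..})) \<and> f' 0 = 0"
    if f: "is_delay_solution \<Delta> f" for f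
  proof -
    obtain f' where f': "\<forall>t\<in>{0..}. (f has_real_derivative f' t) (at t within {0..})"
      "abs_continuous_on {0..} f'"
      "AE t\<in>{0..} in lebesgue. \<exists>d. (f' has_real_derivative d) (at t within {0..}) \<and> d + f (t - \<Delta>) = 0"
      using f unfolding is_delay_solution_def second_deriv_ae_def by blast
    have "AE t\<in>{0..} in lebesgue. (f' has_real_derivative - f (t - \<Delta>)) (at t within {0..})"
      using f'(3) by (rule AE_mp, intro AE_I2) (auto simp: add_eq_0_iff2)
    \<comment> \<open>The prescribed slope at 0 is a two-sided derivative; uniqueness of the
      one-sided derivative identifies it with \<open>f' 0\<close>.\<close>
    moreover have "(f has_real_derivative 0) (at 0 within {0..})"
      using f unfolding is_delay_solution_def by (blast intro: has_field_derivative_at_within)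
    then have "f' 0 = 0"
      using f'(1) by (intro has_real_derivative_within_interval_unique[of f _ 0 "{0..}" _ 0 1]) auto
    ultimately show ?thesis using f'(1,2) by auto
  qed
  obtain r' where r': "\<forall>t\<ge>0. (r has_real_derivative r' t) (at t within {0..})" "abs_continuous_on {0..} r'"
      "AE t\<in>{0..} in lebesgue. (r' has_real_derivative - r (t - \<Delta>)) (at t within {0..})" "r' 0 = 0"
    using ex[OF r] by blast
  obtain q' where q': "\<forall>t\<ge>0. (q has_real_derivative q' t) (at t within {0..})" "abs_continuous_on {0..} q'"
      "AE t\<in>{0..} in lebesgue. (q' has_real_derivative - q (t - \<Delta>)) (at t within {0..})" "q' 0 = 0"
    using ex[OF q] by blast
  define d where "d t = r t + - q t" for t
  define e where "e t = r' t + - q' t" for t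
  have ind: "(\<forall>t\<le>real n / 2. d t = 0) \<and> e (real n / 2) = 0" for n
  proof (induction n)
    case 0
    then show ?case using r q r'(4) q'(4) by (auto simp: is_delay_solution_def d_def e_def)
  next
    case (Suc n)
    have "(\<forall>t\<le>real n / 2 + 1 / 2. d t = 0) \<and> e (real n / 2 + 1 / 2) = 0"
    proof (rule delay_difference_vanishes_step[OF \<open>\<Delta> \<ge> 0\<close>])
      show "(d has_real_derivative e t) (at t within {0..})" if "t \<ge> 0" for t
        unfolding d_def e_def using r'(1) q'(1) that by (intro DERIV_add DERIV_minus) auto
      show "abs_continuous_on {0..} e"
        unfolding e_def[abs_def] by (intro abs_continuous_on_add abs_continuous_on_uminus r'(2) q'(2))
      show "AE t\<in>{0..} in lebesgue. (e has_real_derivative - d (t - \<Delta>)) (at t within {0..})"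
        using r'(3) q'(3)
      proof eventually_elim
        case (elim t)
        show ?case
        proof
          assume "t \<in> {0..}"
          then have "((\<lambda>t. r' t + - q' t) has_real_derivative - r (t - \<Delta>) + - (- q (t - \<Delta>))) (at t within {0..})"
            using elim by (intro DERIV_add DERIV_minus) auto
          then show "(e has_real_derivative - d (t - \<Delta>)) (at t within {0..})"
            unfolding e_def[abs_def] d_def by simp
        qed
      qed
    qed (use Suc in auto)
    then show ?case by (simp add: add_divide_distrib add.commute)
  qed
  show ?thesis
  proof
    fix t
    obtain n where "2 * t < real n" using reals_Archimedean2 by blast
    then have "d t = 0" using ind[of n] by simp
    then show "r t = q t" by (simp add: d_def)
  qed
qed

section \<open>Existence of the delayed cosine by an explicit series\<close>

lemma has_field_derivative_Un:
  assumes "(f has_field_derivative D) (at x within A)" "(f has_field_derivative D) (at x within B)"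
  shows "(f has_field_derivative D) (at x within (A \<union> B))"
  using assms by (simp add: has_field_derivative_iff Lim_within_Un)

text \<open>The exponent is at least 2, so both one-sided derivatives vanish at the kink
  \<open>t = c\<close> and the truncated power is differentiable there as well.\<close>

lemma has_real_derivative_pos_part_power:
  "((\<lambda>t. max 0 (t - c) ^ (n + 2)) has_real_derivative real (n + 2) * max 0 (t - c) ^ (n + 1)) (at t)"
proof -
  have right: "((\<lambda>t. max 0 (t - c) ^ (n + 2)) has_real_derivative real (n + 2) * max 0 (t - c) ^ (n + 1)) (at t within {c..})"
    if "t \<ge> c" for t
  proof (rule has_field_derivative_transform_within[of _ _ _ _ 1])
    show "((\<lambda>t. (t - c) ^ (n + 2)) has_real_derivative real (n + 2) * max 0 (t - c) ^ (n + 1)) (at t within {c..})"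
    proof -
      have "((\<lambda>t. t - c) has_real_derivative 1) (at t within {c..})"
        by (auto intro!: derivative_eq_intros)
      from DERIV_power[OF this, of "n + 2"] show ?thesis using that by simp
    qed
  qed (use that in auto)
  have left: "((\<lambda>t. max 0 (t - c) ^ (n + 2)) has_real_derivative real (n + 2) * max 0 (t - c) ^ (n + 1)) (at t within {..c})"
    if "t \<le> c" for t
  proof (rule has_field_derivative_transform_within[of "\<lambda>t. 0" _ _ _ 1])
    show "((\<lambda>t. 0) has_real_derivative real (n + 2) * max 0 (t - c) ^ (n + 1)) (at t within {..c})"
      using that by (auto intro!: derivative_eq_intros)
  qed (use that in auto)
  consider "t < c" | "t = c" | "t > c" by linarith
  then show ?thesis
  proof cases
    case 1
    then have "at t within {..c} = at t" by (intro at_within_interior) simp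
    then show ?thesis using left[OF less_imp_le[OF 1]] by (simp only:)
  next
    case 2
    have "{..c} \<union> {c..} = UNIV" by auto
    then show ?thesis using has_field_derivative_Un[OF left right, of t] 2 by (simp only: order_refl)
  next
    case 3
    then have "at t within {c..} = at t" by (intro at_within_interior) simp
    then show ?thesis using right[OF less_imp_le[OF 3]] by (simp only:)
  qed
qed

text \<open>For \<open>n = 2, 1, 0\<close> these are, up to sign, the terms \<open>k + 1\<close> of the delayed cosine series
  \<open>1 + (\<Sum>k\<ge>1. (-1)^k (t - (k - 1) \<Delta>)\<^sub>+^(2k) / (2k)!)\<close> and of its first two derivatives.\<close>

definition delay_term :: "real \<Rightarrow> nat \<Rightarrow> nat \<Rightarrow> real \<Rightarrow> real" where
  "delay_term \<Delta> n k t = (-1) ^ k * (max 0 (t - real k * \<Delta>) ^ (2 * k + n) / fact (2 * k + n))"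

definition delay_series :: "real \<Rightarrow> nat \<Rightarrow> real \<Rightarrow> real" where
  "delay_series \<Delta> n t = (\<Sum>k. delay_term \<Delta> n k t)"

text \<open>The majorant is a multiple of the exponential series at \<open>B\<^sup>2\<close>. It
  depends neither on \<open>t\<close> nor on \<open>n\<close>, so it serves both pointwise
  convergence and the Weierstrass test for all three series.\<close>

lemma norm_delay_term_le:
  assumes "\<Delta> \<ge> 0" "n \<le> 2" "t \<le> B" "1 \<le> B"
  shows "norm (delay_term \<Delta> n k t) \<le> B\<^sup>2 * (inverse (fact k) * (B\<^sup>2) ^ k)"
proof -
  have "max 0 (t - real k * \<Delta>) ^ (2 * k + n) \<le> B ^ (2 * k + n)"
    using assms by (intro power_mono) (auto intro: order_trans[of _ t])
  also have "\<dots> \<le> B ^ (2 * k + 2)" using assms by (intro power_increasing) auto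
  also have "\<dots> = B\<^sup>2 * (B\<^sup>2) ^ k" by (metis power_add power_mult mult.commute)
  finally have "max 0 (t - real k * \<Delta>) ^ (2 * k + n) / fact (2 * k + n) \<le> B\<^sup>2 * (B\<^sup>2) ^ k / fact k"
    by (intro frac_le fact_mono) auto
  then show ?thesis by (simp add: delay_term_def abs_mult field_simps)
qed

lemma summable_delay_bound: "summable (\<lambda>k. B\<^sup>2 * (inverse (fact k) * (B\<^sup>2) ^ k) :: real)"
  by (intro summable_mult summable_exp)

lemma summable_delay_term:
  assumes "\<Delta> \<ge> 0" "n \<le> 2"
  shows "summable (\<lambda>k. delay_term \<Delta> n k t)"
  using norm_delay_term_le[OF assms, of t "max 1 t"]
  by (intro summable_comparison_test'[OF summable_delay_bound[of "max 1 t"], of 0]) auto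

text \<open>Differentiation lowers the exponent and the factorial together, hence \<open>n\<close>
  by one. The derivative is taken within the half-line because for \<open>k = n = 0\<close> the
  function is the positive part of \<open>t\<close>, which has a corner at 0; in all other cases the
  exponent is at least 2.\<close>

lemma delay_term_deriv:
  assumes "\<Delta> \<ge> 0" "t \<ge> 0"
  shows "(delay_term \<Delta> (Suc n) k has_real_derivative delay_term \<Delta> n k t) (at t within {0..})"
proof -
  have fact: "real (2 * k + Suc n) / fact (2 * k + Suc n) = 1 / fact (2 * k + n)"
  proof -
    have "(fact (2 * k + Suc n) :: real) = real (2 * k + Suc n) * fact (2 * k + n)" by simp
    then show ?thesis by (simp only: nonzero_divide_mult_cancel_left of_nat_eq_0_iff)
  qed
  have "((\<lambda>t. max 0 (t - real k * \<Delta>) ^ (2 * k + Suc n)) has_real_derivative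
      real (2 * k + Suc n) * max 0 (t - real k * \<Delta>) ^ (2 * k + n)) (at t within {0..})"
  proof (cases "2 * k + n")
    case 0
    then have "k = 0" "n = 0" by auto
    have "((\<lambda>t. max 0 t) has_real_derivative 1) (at t within {0..})"
      by (rule has_field_derivative_transform_within[of "\<lambda>t. t" _ _ _ 1]) (use assms in auto)
    then show ?thesis using \<open>k = 0\<close> \<open>n = 0\<close> by simp
  next
    case (Suc m)
    then have "2 * k + n = m + 1" "2 * k + Suc n = m + 2" by auto
    then show ?thesis
      using has_real_derivative_pos_part_power[of "real k * \<Delta>" m t, THEN has_field_derivative_at_within]
      by (simp only:)
  qed
  from DERIV_cmult[OF DERIV_cdivide[OF this, of "fact (2 * k + Suc n)"], of "(-1) ^ k"]
  have "(delay_term \<Delta> (Suc n) k has_real_derivative (-1) ^ k * (real (2 * k + Suc n) *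
      max 0 (t - real k * \<Delta>) ^ (2 * k + n) / fact (2 * k + Suc n))) (at t within {0..})"
    unfolding delay_term_def[abs_def] .
  also have "real (2 * k + Suc n) * max 0 (t - real k * \<Delta>) ^ (2 * k + n) / fact (2 * k + Suc n)
      = max 0 (t - real k * \<Delta>) ^ (2 * k + n) * (real (2 * k + Suc n) / fact (2 * k + Suc n))"
    by simp
  finally show ?thesis unfolding fact delay_term_def by simp
qed

lemma delay_series_deriv:
  assumes "\<Delta> \<ge> 0" "n \<le> 1" "t \<ge> 0"
  shows "(delay_series \<Delta> (Suc n) has_real_derivative delay_series \<Delta> n t) (at t within {0..})"
proof -
  \<comment> \<open>Uniform convergence is available on bounded intervals only. This one reaches
    beyond \<open>t\<close>, so the derivative within it agrees with the derivative within the
    half-line.\<close>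
  define B where "B = t + 1"
  have "\<exists>g. \<forall>x\<in>{0..B}. (\<lambda>k. delay_term \<Delta> (Suc n) k x) sums g x \<and>
      (g has_real_derivative delay_series \<Delta> n x) (at x within {0..B})"
  proof (rule has_field_derivative_series)
    show "(delay_term \<Delta> (Suc n) k has_real_derivative delay_term \<Delta> n k x) (at x within {0..B})"
      if "x \<in> {0..B}" for k x
      using delay_term_deriv[of \<Delta> x n k] assms that by (auto intro: DERIV_subset)
    show "uniform_limit {0..B} (\<lambda>m x. \<Sum>k<m. delay_term \<Delta> n k x) (delay_series \<Delta> n) sequentially"
      unfolding delay_series_def[abs_def]
      using assms by (intro Weierstrass_m_test[OF _ summable_delay_bound[of B]] norm_delay_term_le)
        (auto simp: B_def)
    show "summable (\<lambda>k. delay_term \<Delta> (Suc n) k 0)" "0 \<in> {0..B}"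
      using assms by (auto intro: summable_delay_term simp: B_def)
  qed auto
  then obtain g where g: "\<And>x. x \<in> {0..B} \<Longrightarrow> (\<lambda>k. delay_term \<Delta> (Suc n) k x) sums g x"
    "\<And>x. x \<in> {0..B} \<Longrightarrow> (g has_real_derivative delay_series \<Delta> n x) (at x within {0..B})" by blast
  have t: "t \<in> {0..B}" using assms by (simp add: B_def)
  have "(delay_series \<Delta> (Suc n) has_real_derivative delay_series \<Delta> n t) (at t within {0..B})"
  proof (rule has_field_derivative_transform_within[OF g(2)[OF t], of 1])
    show "g x = delay_series \<Delta> (Suc n) x" if "x \<in> {0..B}" for x
      using g(1)[OF that] by (simp add: delay_series_def sums_iff)
  qed (use t in auto)
  moreover have "at t within {0..B} = at t within {0..}"
    by (rule at_within_nhd[of _ "{..<B}"]) (use assms in \<open>auto simp: B_def\<close>)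
  ultimately show ?thesis by simp
qed

lemma delay_series_2_nonpos: "t \<le> 0 \<Longrightarrow> \<Delta> \<ge> 0 \<Longrightarrow> delay_series \<Delta> 2 t = 0"
proof -
  assume "t \<le> 0" "\<Delta> \<ge> 0"
  then have "delay_term \<Delta> 2 k t = 0" for k
  proof -
    have "t - real k * \<Delta> \<le> 0" using \<open>t \<le> 0\<close> mult_nonneg_nonneg[of "real k" \<Delta>] \<open>\<Delta> \<ge> 0\<close> by linarith
    then show ?thesis by (simp add: delay_term_def max_absorb1)
  qed
  then show ?thesis by (simp add: delay_series_def)
qed

text \<open>The delay equation at the level of series: shifting the index by one delays the argument
  by \<Delta>, trades two units of \<open>n\<close> and flips the sign. The term split off is a
  zeroth power, hence 1 for negative \<open>t\<close> also.\<close>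

lemma delay_series_0:
  assumes "\<Delta> \<ge> 0"
  shows "delay_series \<Delta> 0 t = 1 - delay_series \<Delta> 2 (t - \<Delta>)"
proof -
  have "delay_term \<Delta> 0 (Suc k) t = - delay_term \<Delta> 2 k (t - \<Delta>)" for k
  proof -
    have "t - real (Suc k) * \<Delta> = t - \<Delta> - real k * \<Delta>" by (simp add: algebra_simps)
    moreover have "2 * Suc k + 0 = 2 * k + 2" by simp
    ultimately show ?thesis unfolding delay_term_def by (simp only: power_Suc mult_minus_left mult_1_left)
  qed
  moreover have "delay_term \<Delta> 0 0 t = 1" by (simp add: delay_term_def)
  ultimately have "(\<Sum>k. - delay_term \<Delta> 2 k (t - \<Delta>)) = delay_series \<Delta> 0 t - 1"
    using suminf_split_head[OF summable_delay_term[OF assms, of 0 t]] by (simp add: delay_series_def)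
  then show ?thesis
    using suminf_minus[OF summable_delay_term[OF assms, of 2 "t - \<Delta>"]] by (simp add: delay_series_def)
qed

lemma delay_series_deriv_1:
  assumes "\<Delta> \<ge> 0" "t \<ge> 0"
  shows "((\<lambda>t. 1 - delay_series \<Delta> 2 t) has_real_derivative - delay_series \<Delta> 1 t) (at t within {0..})"
  using DERIV_diff[OF DERIV_const[of 1] delay_series_deriv[OF assms(1), of 1 t]] assms(2)
  by (simp add: numeral_2_eq_2)

lemma delay_series_deriv_2:
  assumes "\<Delta> \<ge> 0" "t \<ge> 0"
  shows "((\<lambda>t. - delay_series \<Delta> 1 t) has_real_derivative - (1 - delay_series \<Delta> 2 (t - \<Delta>))) (at t within {0..})"
  using DERIV_minus[OF delay_series_deriv[OF assms(1), of 0 t]] assms by (simp add: delay_series_0)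

lemma delay_series_1_0: "\<Delta> \<ge> 0 \<Longrightarrow> delay_series \<Delta> 1 0 = 0"
proof -
  assume "\<Delta> \<ge> 0"
  then have "delay_term \<Delta> 1 k 0 = 0" for k by (simp add: delay_term_def max_absorb1)
  then show ?thesis by (simp add: delay_series_def)
qed

lemma continuous_on_delay_series_2:
  assumes "\<Delta> \<ge> 0"
  shows "continuous_on UNIV (\<lambda>t. 1 - delay_series \<Delta> 2 t)"
proof -
  have "continuous_on {0..} (\<lambda>t. 1 - delay_series \<Delta> 2 t)"
    by (rule DERIV_continuous_on[OF delay_series_deriv_1[OF assms]]) simp
  moreover have "continuous_on {..0} (\<lambda>t. 1 - delay_series \<Delta> 2 t)"
    by (rule continuous_on_eq[of _ "\<lambda>t. 1"]) (use assms in \<open>auto simp: delay_series_2_nonpos\<close>)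
  moreover have "{0::real..} \<union> {..0} = UNIV" by auto
  ultimately show ?thesis by (metis continuous_on_closed_Un closed_atLeast closed_atMost)
qed

lemma is_delay_solution_delay_series:
  assumes "\<Delta> \<ge> 0"
  shows "is_delay_solution \<Delta> (\<lambda>t. 1 - delay_series \<Delta> 2 t)"
  unfolding is_delay_solution_def second_deriv_ae_def
proof (intro conjI exI[of _ "\<lambda>t. - delay_series \<Delta> 1 t"] ballI allI impI AE_I2)
  fix t :: real assume t: "t \<in> {0..}"
  then show "((\<lambda>t. 1 - delay_series \<Delta> 2 t) has_real_derivative - delay_series \<Delta> 1 t) (at t within {0..})"
    using delay_series_deriv_1[OF assms] by simp
  show "\<exists>d. ((\<lambda>t. - delay_series \<Delta> 1 t) has_real_derivative d) (at t within {0..}) \<and>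
      d + (1 - delay_series \<Delta> 2 (t - \<Delta>)) = 0"
    using delay_series_deriv_2[OF assms, of t] t
    by (intro exI[of _ "- (1 - delay_series \<Delta> 2 (t - \<Delta>))"] conjI) simp_all
next
  show "abs_continuous_on {0..} (\<lambda>t. 1 - delay_series \<Delta> 2 t)"
  proof (rule abs_continuous_on_C1)
    show "continuous_on {0..} (\<lambda>t. - delay_series \<Delta> 1 t)"
      by (rule DERIV_continuous_on[OF delay_series_deriv_2[OF assms]]) simp
  qed (use delay_series_deriv_1[OF assms] in simp)
  show "abs_continuous_on {0..} (\<lambda>t. - delay_series \<Delta> 1 t)"
  proof (rule abs_continuous_on_C1)
    show "continuous_on {0..} (\<lambda>t. - (1 - delay_series \<Delta> 2 (t - \<Delta>)))"
      by (intro continuous_on_minus, rule continuous_on_compose2[OF continuous_on_delay_series_2[OF assms]])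
        (auto intro!: continuous_intros)
  qed (use delay_series_deriv_2[OF assms] in simp)
next
  show "1 - delay_series \<Delta> 2 t = 1" if "t \<le> 0" for t
    using delay_series_2_nonpos[OF that assms] by simp
  have right: "((\<lambda>t. 1 - delay_series \<Delta> 2 t) has_real_derivative 0) (at 0 within {0..})"
    using delay_series_deriv_1[OF assms, of 0] delay_series_1_0[OF assms] by simp
  have left: "((\<lambda>t. 1 - delay_series \<Delta> 2 t) has_real_derivative 0) (at 0 within {..0})"
    by (rule has_field_derivative_transform_within[of "\<lambda>t. 1" _ _ _ 1])
      (use assms in \<open>auto simp: delay_series_2_nonpos\<close>)
  have "{..0} \<union> {0::real..} = UNIV" by auto
  then show "((\<lambda>t. 1 - delay_series \<Delta> 2 t) has_real_derivative 0) (at 0)"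
    using has_field_derivative_Un[OF left right] by simp
qed

text \<open>Existence and uniqueness together make the definite description denote the
  series.\<close>

lemma delay_cos_eq:
  assumes "\<Delta> \<ge> 0"
  shows "delay_cos \<Delta> = (\<lambda>t. 1 - delay_series \<Delta> 2 t)"
  unfolding delay_cos_def
proof (rule the_equality[where P="is_delay_solution \<Delta>"])
  show "is_delay_solution \<Delta> (\<lambda>t. 1 - delay_series \<Delta> 2 t)"
    by (rule is_delay_solution_delay_series[OF assms])
  then show "r = (\<lambda>t. 1 - delay_series \<Delta> 2 t)" if "is_delay_solution \<Delta> r" for r
    by (rule is_delay_solution_unique[OF assms that])
qed

section \<open>The first zero of the delayed cosine and continuity of the forcing\<close>

lemma continuous_on_delay_cos:
  assumes "\<Delta> \<ge> 0"
  shows "continuous_on S (delay_cos \<Delta>)"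
  unfolding delay_cos_eq[OF assms]
  by (rule continuous_on_subset[OF continuous_on_delay_series_2[OF assms]]) simp

lemma delay_cos_nonpos: "\<Delta> \<ge> 0 \<Longrightarrow> t \<le> 0 \<Longrightarrow> delay_cos \<Delta> t = 1"
  by (simp add: delay_cos_eq delay_series_2_nonpos)

text \<open>A positive solution would be concave with negative slope at \<open>1\<close>, hence eventually negative.\<close>

lemma delay_cos_has_zero:
  assumes "\<Delta> \<ge> 0"
  shows "\<exists>t>0. delay_cos \<Delta> t = 0"
proof (rule ccontr)
  assume no: "\<not> (\<exists>t>0. delay_cos \<Delta> t = 0)"
  let ?r = "delay_cos \<Delta>" and ?q = "\<lambda>t. - delay_series \<Delta> 1 t"
  \<comment> \<open>The function is 1 on the nonpositive half-line, so a nonpositive value would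
    produce a positive zero by the intermediate value theorem.\<close>
  have pos: "?r t > 0" for t
  proof (rule ccontr)
    assume neg: "\<not> ?r t > 0"
    then have "t > 0" using delay_cos_nonpos[OF assms, of t] by (cases "t \<le> 0") auto
    then obtain s where "0 \<le> s" "s \<le> t" "?r s = 0"
      using IVT2'[of ?r t 0 0] neg delay_cos_nonpos[OF assms, of 0] continuous_on_delay_cos[OF assms] by auto
    then show False using no delay_cos_nonpos[OF assms, of 0] by (cases "s = 0") auto
  qed
  have r: "(?r has_real_derivative ?q t) (at t within {0..})" if "t \<in> {0..}" for t
    using delay_series_deriv_1[OF assms, of t] that by (simp add: delay_cos_eq[OF assms])
  have q: "(?q has_real_derivative - ?r (t - \<Delta>)) (at t within {0..})" if "t \<in> {0..}" for t
    using delay_series_deriv_2[OF assms, of t] that by (simp add: delay_cos_eq[OF assms])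
  have dec: "?q t < ?q s" if "0 \<le> s" "s < t" for s t
  proof -
    have "{s..t} \<subseteq> {0..}" using that by auto
    then obtain \<xi> where "?q t - ?q s = - ?r (\<xi> - \<Delta>) * (t - s)"
      using mvt_within_real[OF \<open>s < t\<close> _ q] by blast
    moreover have "\<dots> < 0" using pos[of "\<xi> - \<Delta>"] that by simp
    ultimately show ?thesis by simp
  qed
  have q1: "?q 1 < 0" using dec[of 0 1] delay_series_1_0[OF assms] by simp
  \<comment> \<open>The point where the line through \<open>(1, ?r 1)\<close> with slope
    \<open>?q 1\<close> reaches height -1; by concavity the function lies below that line.\<close>
  define T where "T = 1 - (?r 1 + 1) / ?q 1"
  have "T > 1" using q1 pos[of 1] by (simp add: T_def divide_less_0_iff)
  then have "{1..T} \<subseteq> {0..}" by auto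
  then obtain \<xi> where \<xi>: "1 < \<xi>" "?r T - ?r 1 = ?q \<xi> * (T - 1)"
    using mvt_within_real[OF \<open>T > 1\<close> _ r] by blast
  have "?q \<xi> * (T - 1) \<le> ?q 1 * (T - 1)"
    using dec[of 1 \<xi>] \<xi> \<open>T > 1\<close> by (intro mult_right_mono) auto
  also have "\<dots> = - (?r 1 + 1)" using q1 by (simp add: T_def)
  finally have "?r T < 0" using \<xi> by linarith
  then show False using pos[of T] by simp
qed

text \<open>\<open>LEAST\<close> over the reals is meaningful only if the minimum is attained. Zeros
  are collected on \<open>t \<ge> 0\<close> to get a closed set, which contains its infimum; the
  value 1 at 0 then makes that infimum positive.\<close>

lemma delay_cos_first_zero:
  assumes "\<Delta> \<ge> 0"
  shows "delay_cos \<Delta> (first_zero \<Delta>) = 0"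
proof -
  define Z where "Z = {t. 0 \<le> t \<and> delay_cos \<Delta> t = 0}"
  have Zeq: "Z = {0..} \<inter> delay_cos \<Delta> -` {0}" by (auto simp: Z_def)
  have "Z \<noteq> {}" using delay_cos_has_zero[OF assms] less_imp_le unfolding Z_def by blast
  moreover have "closed Z" unfolding Zeq
    by (intro closed_Int closed_vimage continuous_on_delay_cos assms) auto
  moreover have bdd: "bdd_below Z" by (auto simp: Z_def intro!: bdd_belowI[of _ 0])
  ultimately have "Inf Z \<in> Z" by (intro closed_contains_Inf)
  moreover from this have "Inf Z \<noteq> 0" using delay_cos_nonpos[OF assms, of 0] by (auto simp: Z_def)
  ultimately have z: "0 < Inf Z \<and> delay_cos \<Delta> (Inf Z) = 0" by (auto simp: Z_def)
  moreover have "Inf Z \<le> t" if "0 < t \<and> delay_cos \<Delta> t = 0" for t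
    using that by (intro cInf_lower bdd) (auto simp: Z_def)
  ultimately have "first_zero \<Delta> = Inf Z" unfolding first_zero_def by (rule Least_equality)
  then show ?thesis using z by simp
qed

lemma continuous_on_forcing:
  assumes "\<Delta> \<ge> 0"
  shows "continuous_on {..0} (forcing \<rho> \<Delta>)"
proof -
  have "continuous_on {-\<Delta>..0} (forcing \<rho> \<Delta>)"
  proof (rule continuous_on_eq)
    show "continuous_on {-\<Delta>..0} (\<lambda>v. \<rho> * delay_cos \<Delta> (first_zero \<Delta> - v - \<Delta>))"
      by (intro continuous_on_mult_left, rule continuous_on_compose2[OF continuous_on_delay_cos[OF assms, of UNIV]])
        (auto intro!: continuous_intros)
  qed (auto simp: forcing_def)
  moreover have "continuous_on {..-\<Delta>} (forcing \<rho> \<Delta>)"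
  proof (rule continuous_on_eq)
    show "continuous_on {..-\<Delta>} (\<lambda>v. 0::real)" by simp
    \<comment> \<open>At the junction \<open>v = -\<Delta>\<close> the argument of the delayed
      cosine is exactly \<open>first_zero \<Delta>\<close>, so both pieces give 0.\<close>
    show "0 = forcing \<rho> \<Delta> v" if "v \<in> {..-\<Delta>}" for v
      using that delay_cos_first_zero[OF assms] by (cases "v = -\<Delta>") (auto simp: forcing_def)
  qed
  moreover have "{-\<Delta>..0} \<union> {..-\<Delta>} = {..0}" using assms by auto
  ultimately show ?thesis
    by (metis continuous_on_closed_Un closed_atMost closed_atLeastAtMost)
qed

section \<open>Integral operator and comparison\<close>

text \<open>The double integral that fixes the step width, after integration by parts.\<close>

definition moment :: "(real \<Rightarrow> real) \<Rightarrow> real \<Rightarrow> real" where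
  "moment g w = integral {-w..0} (\<lambda>v. - v * g v)"

text \<open>The kernel \<open>min (-t) (-v)\<close> is the Green function of \<open>y'' = -g\<close> with \<open>y 0 = 0\<close> and
  \<open>y' (-w) = 0\<close>. Unlike the iterated integral it gives the constant continuation to \<open>t \<le> -w\<close> as well.\<close>

definition profile :: "(real \<Rightarrow> real) \<Rightarrow> real \<Rightarrow> real \<Rightarrow> real" where
  "profile g w t = integral {-w..0} (\<lambda>v. min (-t) (-v) * g v)"

lemma profile_eq_moment: "t \<le> - w \<Longrightarrow> profile g w t = moment g w"
  unfolding profile_def moment_def by (rule integral_cong) auto

lemma profile_0: "profile g w 0 = 0"
proof -
  have "profile g w 0 = integral {-w..0} (\<lambda>v. 0)"
    unfolding profile_def by (rule integral_cong) auto
  then show ?thesis by simp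
qed

text \<open>On \<open>{-w..t}\<close> the kernel is the constant \<open>- t\<close> and contributes
  \<open>- t * ?P t\<close>. Integration by parts on \<open>{t..0}\<close> yields the opposite
  boundary term, while the one at 0 vanishes, so only the integral of \<open>?P\<close>
  remains.\<close>

lemma profile_eq_nested:
  assumes g: "continuous_on {-w..0} g" and t: "t \<in> {-w..0}"
  shows "profile g w t = integral {t..0} (\<lambda>u. integral {-w..u} g)"
proof -
  let ?P = "\<lambda>u. integral {-w..u} g"
  have P: "(?P has_real_derivative g u) (at u within {-w..0})" if "u \<in> {-w..0}" for u
    using integral_has_real_derivative[OF g that] .
  have contP: "continuous_on {-w..0} ?P" by (rule DERIV_continuous_on[OF P])
  have sub: "{t..0} \<subseteq> {-w..0}" "{-w..t} \<subseteq> {-w..0}" using t by auto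
  have "((\<lambda>v. - v * g v - ?P v) has_integral (- 0 * ?P 0 - (- t * ?P t))) {t..0}"
  proof (rule fundamental_theorem_of_calculus)
    fix v assume v: "v \<in> {t..0}"
    have "((\<lambda>v. - v * ?P v) has_real_derivative - v * g v + (- 1) * ?P v) (at v within {-w..0})"
      using v sub by (intro DERIV_mult' P) (auto intro!: derivative_eq_intros)
    then show "((\<lambda>v. - v * ?P v) has_vector_derivative - v * g v - ?P v) (at v within {t..0})"
      unfolding has_real_derivative_iff_has_vector_derivative
      using sub(1) by (auto intro: has_vector_derivative_within_subset)
  qed (use t in auto)
  then have "integral {t..0} (\<lambda>v. - v * g v - ?P v) = t * ?P t"
    by (simp add: integral_unique)
  moreover have "integral {t..0} (\<lambda>v. - v * g v - ?P v)
      = integral {t..0} (\<lambda>v. - v * g v) - integral {t..0} ?P"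
    by (intro integral_diff integrable_continuous_real continuous_intros
        continuous_on_subset[OF g sub(1)] continuous_on_subset[OF contP sub(1)])
  ultimately have right: "integral {t..0} (\<lambda>v. - v * g v) = t * ?P t + integral {t..0} ?P"
    by simp
  have "profile g w t = integral {-w..t} (\<lambda>v. min (-t) (-v) * g v) + integral {t..0} (\<lambda>v. min (-t) (-v) * g v)"
    unfolding profile_def using t
    by (intro Henstock_Kurzweil_Integration.integral_combine[symmetric] integrable_continuous_real continuous_intros g) auto
  also have "integral {-w..t} (\<lambda>v. min (-t) (-v) * g v) = integral {-w..t} (\<lambda>v. - t * g v)"
    by (rule integral_cong) auto
  also have "integral {t..0} (\<lambda>v. min (-t) (-v) * g v) = integral {t..0} (\<lambda>v. - v * g v)"
    by (rule integral_cong) auto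
  finally show ?thesis unfolding right by simp
qed

text \<open>The double integral over all of \<open>{-w..0}\<close> is the moment, and its portion
  over \<open>{t..0}\<close> is the profile. Once the moment is 1, one minus the iterated integral
  is therefore the profile.\<close>

lemma nested_integral_eq:
  assumes g: "continuous_on {-w..0} g" and t: "t \<in> {-w..0}"
  shows "integral {-w..t} (\<lambda>u. integral {-w..u} g) = moment g w - profile g w t"
proof -
  let ?P = "\<lambda>u. integral {-w..u} g"
  have "continuous_on {-w..0} ?P"
    by (rule DERIV_continuous_on[OF integral_has_real_derivative[OF g]])
  then have "integral {-w..t} ?P + integral {t..0} ?P = integral {-w..0} ?P"
    using t by (intro Henstock_Kurzweil_Integration.integral_combine integrable_continuous_real) auto
  moreover have "integral {-w..0} ?P = moment g w"
    using profile_eq_nested[OF g, of "-w"] profile_eq_moment[of "-w" w g] t by simp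
  ultimately show ?thesis using profile_eq_nested[OF g t] by simp
qed

lemma has_real_derivative_profile:
  assumes g: "continuous_on {-w..0} g" and t: "t \<in> {-w..0}"
  shows "(profile g w has_real_derivative - integral {-w..t} g) (at t within {-w..0})"
proof (rule has_field_derivative_transform_within[of _ _ _ _ 1])
  show "((\<lambda>t. integral {t..0} (\<lambda>u. integral {-w..u} g)) has_real_derivative - integral {-w..t} g)
      (at t within {-w..0})"
    by (rule integral_has_real_derivative'[OF _ t])
      (rule DERIV_continuous_on[OF integral_has_real_derivative[OF g]])
qed (use profile_eq_nested[OF g] t in auto)

lemma continuous_on_profile:
  assumes g: "continuous_on {-w..0} g" and "w > 0"
  shows "continuous_on {..0} (profile g w)"
proof -
  have "continuous_on {-w..0} (profile g w)"
    by (rule DERIV_continuous_on[OF has_real_derivative_profile[OF g]])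
  moreover have "continuous_on {..-w} (profile g w)"
    by (rule continuous_on_eq[of _ "\<lambda>t. moment g w"]) (auto simp: profile_eq_moment)
  moreover have "{-w..0} \<union> {..-w} = {..0}" using \<open>w > 0\<close> by auto
  ultimately show ?thesis using continuous_on_closed_Un[of "{-w..0}" "{..-w}"] by simp
qed

section \<open>Monotonicity and Lipschitz bounds for moments and profiles\<close>

lemma integrable_kernel:
  fixes g :: "real \<Rightarrow> real"
  assumes "continuous_on {..0} g" "b \<le> 0"
  shows "(\<lambda>v. min c (- v) * g v) integrable_on {a..b}" "(\<lambda>v. - v * g v) integrable_on {a..b}"
proof -
  have "continuous_on {a..b} g" by (rule continuous_on_subset[OF assms(1)]) (use assms(2) in auto)
  then show "(\<lambda>v. min c (- v) * g v) integrable_on {a..b}" "(\<lambda>v. - v * g v) integrable_on {a..b}"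
    by (auto intro!: integrable_continuous_real continuous_intros)
qed

lemma moment_mono:
  assumes "continuous_on {..0} g" "continuous_on {..0} h" "\<And>v. v \<le> 0 \<Longrightarrow> h v \<le> g v"
  shows "moment h w \<le> moment g w"
  unfolding moment_def
proof (rule integral_le[OF integrable_kernel(2) integrable_kernel(2)])
  show "- v * h v \<le> - v * g v" if "v \<in> {-w..0}" for v
    using that assms(3) by (intro mult_left_mono) auto
qed (use assms in auto)

lemma profile_antitone:
  assumes "continuous_on {..0} g" "\<And>v. v \<le> 0 \<Longrightarrow> 0 \<le> g v" "s \<le> t"
  shows "profile g w t \<le> profile g w s"
  unfolding profile_def
  by (rule integral_le) (use assms in \<open>auto intro!: integrable_kernel mult_right_mono\<close>)

lemma profile_le_moment:
  assumes "continuous_on {..0} g" "\<And>v. v \<le> 0 \<Longrightarrow> 0 \<le> g v"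
  shows "profile g w t \<le> moment g w"
  unfolding profile_def moment_def
proof (rule integral_le[OF integrable_kernel(1) integrable_kernel(2)])
  show "min (-t) (-v) * g v \<le> - v * g v" if "v \<in> {-w..0}" for v
    using that assms(2) by (intro mult_right_mono) auto
qed (use assms in auto)

text \<open>The kernel is 1-Lipschitz in \<open>t\<close>, and the weight has total mass at most
  \<open>w * C\<close>.\<close>

lemma profile_lipschitz:
  assumes "continuous_on {..0} g" "\<And>v. v \<in> {-w..0} \<Longrightarrow> 0 \<le> g v \<and> g v \<le> C" "0 < w" "s \<le> t"
  shows "profile g w s - profile g w t \<le> w * C * (t - s)"
proof -
  have "profile g w s - profile g w t = integral {-w..0} (\<lambda>v. min (-s) (-v) * g v - min (-t) (-v) * g v)"
    unfolding profile_def by (rule integral_diff[symmetric]) (use assms(1) in \<open>auto intro!: integrable_kernel\<close>)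
  also have "\<dots> \<le> integral {-w..0} (\<lambda>v. (t - s) * C)"
  proof (rule integral_le)
    fix v assume v: "v \<in> {-w..0}"
    have "min (-s) (-v) * g v - min (-t) (-v) * g v = (min (-s) (-v) - min (-t) (-v)) * g v"
      by (simp add: left_diff_distrib)
    also have "\<dots> \<le> (t - s) * C"
      using assms(2)[OF v] assms(4) by (intro mult_mono) auto
    finally show "min (-s) (-v) * g v - min (-t) (-v) * g v \<le> (t - s) * C" .
  qed (use assms(1) in \<open>auto intro!: integrable_diff integrable_kernel\<close>)
  also have "\<dots> = w * C * (t - s)" using assms(3) by simp
  finally show ?thesis .
qed

lemma moment_strict_mono:
  assumes g: "continuous_on {..0} g" and pos: "\<And>v. v < 0 \<Longrightarrow> 0 < g v" and w: "0 \<le> w" "w < w'"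
  shows "moment g w < moment g w'"
proof -
  have "moment g w' = integral {-w'..-w} (\<lambda>v. - v * g v) + moment g w"
    unfolding moment_def using w integrable_kernel(2)[OF g]
    by (intro Henstock_Kurzweil_Integration.integral_combine[symmetric]) auto
  moreover have "integral {-w'..-w} (\<lambda>v. 0) < integral {-w'..-w} (\<lambda>v. - v * g v)"
  proof (rule integral_less_real)
    show "continuous_on {-w'..-w} (\<lambda>v. - v * g v)"
      by (intro continuous_intros continuous_on_subset[OF g]) (use w in auto)
  qed (use w pos in \<open>auto intro!: mult_neg_pos\<close>)
  ultimately show ?thesis by simp
qed

text \<open>With \<open>c = min (-t) w / w\<close>, the function \<open>v \<mapsto> min (-t) (-v) - c (-v)\<close> is nonnegative on \<open>[-w, 0]\<close>
  and nonpositive to the left of \<open>-w\<close>; integrating it against both weights compares the profiles.\<close>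

lemma profile_mono:
  assumes g: "continuous_on {..0} g" and h: "continuous_on {..0} h"
    and le: "\<And>v. v \<le> 0 \<Longrightarrow> h v \<le> g v" and pos: "\<And>v. v < 0 \<Longrightarrow> 0 < h v"
    and w: "0 < w" "moment g w = 1" and u: "0 < u" "moment h u = 1"
  shows "w \<le> u" and "t \<le> 0 \<Longrightarrow> profile h u t \<le> profile g w t"
proof -
  show "w \<le> u"
  proof (rule ccontr)
    assume "\<not> w \<le> u"
    then have "moment g u < moment g w"
      using u pos le by (intro moment_strict_mono[OF g]) (auto intro: order.strict_trans2 less_imp_le)
    moreover have "moment h u \<le> moment g u" by (rule moment_mono[OF g h le])
    ultimately show False using w u by simp
  qed
  assume "t \<le> 0"
  define c where "c = min (-t) w / w"
  have c: "0 \<le> c" "c \<le> 1" "c * w \<le> - t" using \<open>t \<le> 0\<close> w by (auto simp: c_def field_simps)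
  define k where "k v = min (-t) (-v) - c * (-v)" for v
  have kpos: "0 \<le> k v" if "v \<in> {-w..0}" for v
  proof -
    have "c * (-v) \<le> c * w" using that c by (intro mult_left_mono) auto
    moreover have "c * (-v) \<le> 1 * (-v)" using that c by (intro mult_right_mono) auto
    ultimately show ?thesis using c by (simp add: k_def)
  qed
  have kneg: "k v \<le> 0" if "v \<le> -w" for v
  proof (cases "-t \<le> w")
    case True
    then have "c * w = -t" using w by (simp add: c_def)
    moreover have "c * w \<le> c * (-v)" using that c by (intro mult_left_mono) auto
    ultimately show ?thesis by (simp add: k_def)
  next
    case False
    \<comment> \<open>Here \<open>c = 1\<close>, and \<open>min (-t) (-v)\<close> never exceeds
      \<open>-v\<close>.\<close>
    then show ?thesis using w by (simp add: c_def k_def)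
  qed
  have int: "(\<lambda>v. k v * f v) integrable_on {a..b}" if "continuous_on {..0} f" "b \<le> 0" for f :: "real \<Rightarrow> real" and a b
    unfolding k_def
    by (intro integrable_continuous_real continuous_intros continuous_on_subset[OF that(1)]; use that(2) in auto)
  have k: "integral {-w..0} (\<lambda>v. k v * f v) = profile f w t - c * moment f w" if "continuous_on {..0} f" for f w
  proof -
    have "integral {-w..0} (\<lambda>v. k v * f v) = integral {-w..0} (\<lambda>v. min (-t) (-v) * f v - c * (- v * f v))"
      by (rule integral_cong) (simp add: k_def algebra_simps)
    also have "\<dots> = profile f w t - integral {-w..0} (\<lambda>v. c * (- v * f v))"
      unfolding profile_def
      by (intro integral_diff integrable_on_mult_right integrable_kernel that order_refl)
    finally show ?thesis unfolding moment_def by (simp only: integral_mult_right)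
  qed
  have "integral {-u..0} (\<lambda>v. k v * h v) = integral {-u..-w} (\<lambda>v. k v * h v) + integral {-w..0} (\<lambda>v. k v * h v)"
    using \<open>w \<le> u\<close> w by (intro Henstock_Kurzweil_Integration.integral_combine[symmetric] int h) auto
  also have "integral {-u..-w} (\<lambda>v. k v * h v) \<le> integral {-u..-w} (\<lambda>v. 0)"
  proof (rule integral_le)
    show "k v * h v \<le> 0" if "v \<in> {-u..-w}" for v
      using that kneg[of v] pos[of v] w by (intro mult_nonpos_nonneg) auto
  qed (use w in \<open>auto intro!: int h\<close>)
  also have "integral {-w..0} (\<lambda>v. k v * h v) \<le> integral {-w..0} (\<lambda>v. k v * g v)"
    by (rule integral_le) (use kpos le in \<open>auto intro!: int h g mult_left_mono\<close>)
  \<comment> \<open>Both moments equal 1, so the two terms \<open>c * moment\<close> cancel and only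
    the profiles remain.\<close>
  finally show "profile h u t \<le> profile g w t" using k[OF g, of w] k[OF h, of u] w u by simp
qed

section \<open>The truncated sine as a lower barrier\<close>

definition trunc_sin :: "real \<Rightarrow> real" where
  "trunc_sin v = sin (min (- v) (pi / 2))"

lemma continuous_on_trunc_sin: "continuous_on S trunc_sin"
  unfolding trunc_sin_def[abs_def] by (intro continuous_intros)

lemma trunc_sin_pos: "v < 0 \<Longrightarrow> 0 < trunc_sin v"
  unfolding trunc_sin_def by (rule sin_gt_zero) (auto simp: min_def pi_gt_zero)

lemma trunc_sin_nonneg: "v \<le> 0 \<Longrightarrow> 0 \<le> trunc_sin v"
  using trunc_sin_pos[of v] by (cases "v = 0") (auto simp: trunc_sin_def)

lemma trunc_sin_le_1: "trunc_sin v \<le> 1"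
  by (simp add: trunc_sin_def)

lemma moment_trunc_sin: "moment trunc_sin (pi / 2) = 1"
proof -
  \<comment> \<open>The primitive used is \<open>sin v - v * cos v\<close>.\<close>
  have "((\<lambda>v. v * sin v) has_integral (sin 0 - 0 * cos 0) - (sin (- (pi / 2)) - (- (pi / 2)) * cos (- (pi / 2)))) {- (pi / 2)..0}"
    by (rule fundamental_theorem_of_calculus)
      (auto simp: has_real_derivative_iff_has_vector_derivative[symmetric] intro!: derivative_eq_intros)
  then have "integral {- (pi / 2)..0} (\<lambda>v. v * sin v) = 1" by (simp add: integral_unique)
  moreover have "moment trunc_sin (pi / 2) = integral {- (pi / 2)..0} (\<lambda>v. v * sin v)"
    unfolding moment_def by (rule integral_cong) (auto simp: trunc_sin_def min_def)
  ultimately show ?thesis by simp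
qed

text \<open>The barrier is a fixed point: the inner integral from \<open>- (pi / 2)\<close> to
  \<open>u\<close> is \<open>cos u\<close>, since the cosine vanishes at the lower limit, and
  integrating this over \<open>{t..0}\<close> returns \<open>- sin t\<close>.\<close>

lemma profile_trunc_sin:
  assumes "t \<le> 0"
  shows "profile trunc_sin (pi / 2) t = trunc_sin t"
proof (cases "t \<le> - (pi / 2)")
  case True
  then have "min (- t) (pi / 2) = pi / 2" by simp
  then show ?thesis using True by (simp add: profile_eq_moment moment_trunc_sin trunc_sin_def)
next
  case False
  have P: "integral {- (pi / 2)..u} trunc_sin = cos u" if "u \<in> {t..0}" for u
  proof -
    have "((\<lambda>v. - sin v) has_integral cos u - cos (- (pi / 2))) {- (pi / 2)..u}"
      using that False by (intro fundamental_theorem_of_calculus)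
        (auto simp: has_real_derivative_iff_has_vector_derivative[symmetric] intro!: derivative_eq_intros)
    from integral_unique[OF this] have "integral {- (pi / 2)..u} (\<lambda>v. - sin v) = cos u"
      by (simp only: cos_minus cos_pi_half diff_zero)
    moreover have "integral {- (pi / 2)..u} trunc_sin = integral {- (pi / 2)..u} (\<lambda>v. - sin v)"
      by (rule integral_cong) (use that in \<open>auto simp: trunc_sin_def min_def\<close>)
    ultimately show ?thesis by simp
  qed
  have "profile trunc_sin (pi / 2) t = integral {t..0} (\<lambda>u. integral {- (pi / 2)..u} trunc_sin)"
    using False assms by (intro profile_eq_nested continuous_on_trunc_sin) auto
  also have "\<dots> = integral {t..0} cos" by (rule integral_cong) (rule P)
  also have "\<dots> = sin 0 - sin t"
    using assms by (intro integral_unique fundamental_theorem_of_calculus)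
      (auto simp: has_real_derivative_iff_has_vector_derivative[symmetric] intro!: derivative_eq_intros)
  finally show ?thesis using False assms by (simp add: trunc_sin_def min_def)
qed

text \<open>The moment is continuous in the width, is 0 at width 0 and, by comparison with the
  barrier, at least 1 at \<open>pi / 2\<close>. Strict monotonicity leaves only one
  solution.\<close>

lemma moment_eq_1_unique:
  assumes g: "continuous_on {..0} g" and ge: "\<And>v. v \<le> 0 \<Longrightarrow> trunc_sin v \<le> g v"
  shows "\<exists>!w. 0 < w \<and> moment g w = 1"
proof -
  have pos: "0 < g v" if "v < 0" for v
    using ge[of v] trunc_sin_pos[OF that] that by simp
  have "continuous_on {- (pi / 2)..0} (\<lambda>x. integral {x..0} (\<lambda>v. - v * g v))"
    by (intro indefinite_integral_continuous_1' integrable_kernel g) simp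
  then have cont: "continuous_on {0..pi / 2} (moment g)"
    unfolding moment_def[abs_def]
    by (rule continuous_on_compose2[where f="\<lambda>w. - w"]) (auto intro!: continuous_intros)
  have "moment trunc_sin (pi / 2) \<le> moment g (pi / 2)"
    by (rule moment_mono[OF g continuous_on_trunc_sin ge])
  then have "1 \<le> moment g (pi / 2)" by (simp add: moment_trunc_sin)
  moreover have m0: "moment g 0 = 0" by (simp add: moment_def)
  ultimately obtain w where w: "0 \<le> w" "moment g w = 1"
    using IVT'[of "moment g" 0 1 "pi / 2"] cont by auto
  then have "0 < w" using m0 by (cases "w = 0") auto
  moreover have "v = w" if "0 < v" "moment g v = 1" for v
    using moment_strict_mono[OF g pos, of v w] moment_strict_mono[OF g pos, of w v] that w
    by (cases v w rule: linorder_cases) auto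
  ultimately show ?thesis using w by blast
qed

text \<open>The comparison principle with the fixed point \<open>trunc_sin\<close> of width
  \<open>pi / 2\<close> as the smaller weight; this propagates the barrier through one
  iteration.\<close>

lemma trunc_sin_le_profile:
  assumes g: "continuous_on {..0} g" and ge: "\<And>v. v \<le> 0 \<Longrightarrow> trunc_sin v \<le> g v"
    and w: "0 < w" "moment g w = 1"
  shows "w \<le> pi / 2" and "t \<le> 0 \<Longrightarrow> trunc_sin t \<le> profile g w t"
  using profile_mono(1)[OF g continuous_on_trunc_sin ge trunc_sin_pos w _ moment_trunc_sin]
    profile_mono(2)[OF g continuous_on_trunc_sin ge trunc_sin_pos w _ moment_trunc_sin, of t]
  by (auto simp: profile_trunc_sin)

section \<open>The iteration and its limit\<close>

lemma iterated_integral_eq: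
  assumes "continuous_on {..0} (\<lambda>v. max (b v) (forcing \<rho> \<Delta> v))" "t \<in> {-w..0}"
  shows "iterated_integral \<rho> \<Delta> b w t
    = moment (\<lambda>v. max (b v) (forcing \<rho> \<Delta> v)) w - profile (\<lambda>v. max (b v) (forcing \<rho> \<Delta> v)) w t"
  unfolding iterated_integral_def
  by (rule nested_integral_eq[OF continuous_on_subset[OF assms(1)] assms(2)]) auto

text \<open>The barrier hypothesis on \<open>b\<close> makes the definite description in
  \<open>step_width\<close> well-defined.\<close>

lemma step_width_moment:
  assumes g: "continuous_on {..0} (\<lambda>v. max (b v) (forcing \<rho> \<Delta> v))"
    and ge: "\<And>v. v \<le> 0 \<Longrightarrow> trunc_sin v \<le> b v"
  shows "0 < step_width \<rho> \<Delta> b" "moment (\<lambda>v. max (b v) (forcing \<rho> \<Delta> v)) (step_width \<rho> \<Delta> b) = 1"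
proof -
  let ?g = "\<lambda>v. max (b v) (forcing \<rho> \<Delta> v)"
  have "step_width \<rho> \<Delta> b = (THE w. 0 < w \<and> moment ?g w = 1)"
    unfolding step_width_def
  proof (rule arg_cong[where f=The], rule ext, rule conj_cong[OF refl])
    fix w :: real assume "0 < w"
    then show "(iterated_integral \<rho> \<Delta> b w 0 = 1) = (moment ?g w = 1)"
      using iterated_integral_eq[OF g, of 0 w] by (simp add: profile_0)
  qed
  moreover have "\<exists>!w. 0 < w \<and> moment ?g w = 1"
    by (rule moment_eq_1_unique[OF g]) (use ge in \<open>auto intro: max.coboundedI1\<close>)
  ultimately show "0 < step_width \<rho> \<Delta> b" "moment ?g (step_width \<rho> \<Delta> b) = 1"
    using theI'[of "\<lambda>w. 0 < w \<and> moment ?g w = 1"] by auto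
qed

definition source :: "real \<Rightarrow> real \<Rightarrow> nat \<Rightarrow> real \<Rightarrow> real" where
  "source \<rho> \<Delta> n v = max (beta_seq \<rho> \<Delta> n v) (forcing \<rho> \<Delta> v)"

text \<open>Both branches of the recursion are one profile: its moment is 1, which is its constant
  value for \<open>t \<le> - ?w\<close>, and to the right it is one minus the iterated
  integral.\<close>

lemma beta_seq_Suc_profile:
  assumes g: "continuous_on {..0} (source \<rho> \<Delta> n)"
    and ge: "\<And>v. v \<le> 0 \<Longrightarrow> trunc_sin v \<le> beta_seq \<rho> \<Delta> n v" and "t \<le> 0"
  shows "beta_seq \<rho> \<Delta> (Suc n) t = profile (source \<rho> \<Delta> n) (varpi_seq \<rho> \<Delta> n) t"
proof -
  let ?w = "varpi_seq \<rho> \<Delta> n"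
  have w: "moment (source \<rho> \<Delta> n) ?w = 1"
    using step_width_moment[of "beta_seq \<rho> \<Delta> n"] g ge by (simp add: source_def[abs_def] varpi_seq_def)
  show ?thesis
  proof (cases "t \<le> - ?w")
    case True
    then show ?thesis using w by (simp add: profile_eq_moment Let_def varpi_seq_def)
  next
    case False
    then show ?thesis using iterated_integral_eq[of "beta_seq \<rho> \<Delta> n" \<rho> \<Delta> t ?w] g \<open>t \<le> 0\<close> w
      by (simp add: Let_def varpi_seq_def source_def[abs_def])
  qed
qed

definition beta_lim :: "real \<Rightarrow> real \<Rightarrow> real \<Rightarrow> real" where
  "beta_lim \<rho> \<Delta> t = lim (\<lambda>n. beta_seq \<rho> \<Delta> n t)"

definition source_lim :: "real \<Rightarrow> real \<Rightarrow> real \<Rightarrow> real" where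
  "source_lim \<rho> \<Delta> t = max (beta_lim \<rho> \<Delta> t) (forcing \<rho> \<Delta> t)"

section \<open>Admissibility and monotonicity of the iterates\<close>

context
  fixes \<Delta> \<rho> :: real
  assumes \<Delta>: "0 \<le> \<Delta>"
begin

private abbreviation (input) "\<beta> \<equiv> beta_seq \<rho> \<Delta>"
private abbreviation (input) "W \<equiv> varpi_seq \<rho> \<Delta>"
private abbreviation (input) "G \<equiv> source \<rho> \<Delta>"
private abbreviation (input) "Y \<equiv> beta_lim \<rho> \<Delta>"
private abbreviation (input) "H \<equiv> source_lim \<rho> \<Delta>"

lemma continuous_on_sourceI: "continuous_on {..0} (\<beta> n) \<Longrightarrow> continuous_on {..0} (G n)"
  unfolding source_def[abs_def] by (intro continuous_on_max continuous_on_forcing[OF \<Delta>])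

text \<open>The two properties go through one induction because the next step width is well-defined
  only when both hold.\<close>

lemma beta_seq_admissible: "continuous_on {..0} (\<beta> n) \<and> (\<forall>v\<le>0. trunc_sin v \<le> \<beta> n v)"
proof (induction n)
  case 0
  then show ?case by (simp add: trunc_sin_le_1)
next
  case (Suc n)
  then have g: "continuous_on {..0} (G n)" and ge: "\<And>v. v \<le> 0 \<Longrightarrow> trunc_sin v \<le> \<beta> n v"
    by (auto intro: continuous_on_sourceI)
  then have gg: "\<And>v. v \<le> 0 \<Longrightarrow> trunc_sin v \<le> G n v" by (auto simp: source_def intro: max.coboundedI1)
  have w: "0 < W n" "moment (G n) (W n) = 1"
    using step_width_moment[of "\<beta> n"] g ge by (simp_all add: source_def[abs_def] varpi_seq_def)
  have eq: "\<beta> (Suc n) t = profile (G n) (W n) t" if "t \<le> 0" for t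
    by (rule beta_seq_Suc_profile[OF g ge that])
  have "continuous_on {-W n..0} (G n)" by (rule continuous_on_subset[OF g]) auto
  from continuous_on_profile[OF this w(1)] have "continuous_on {..0} (\<beta> (Suc n))"
    by (rule continuous_on_eq) (use eq in auto)
  moreover have "trunc_sin t \<le> \<beta> (Suc n) t" if "t \<le> 0" for t
    using trunc_sin_le_profile(2)[OF g gg w that] eq[OF that] by simp
  ultimately show ?case by blast
qed

lemma trunc_sin_le_beta_seq: "v \<le> 0 \<Longrightarrow> trunc_sin v \<le> \<beta> n v"
  using beta_seq_admissible by blast

lemma continuous_on_source: "continuous_on {..0} (G n)"
  using beta_seq_admissible continuous_on_sourceI by blast

lemma trunc_sin_le_source: "v \<le> 0 \<Longrightarrow> trunc_sin v \<le> G n v"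
  using trunc_sin_le_beta_seq[of v n] by (auto simp: source_def intro: max.coboundedI1)

lemma source_nonneg: "v \<le> 0 \<Longrightarrow> 0 \<le> G n v"
  using trunc_sin_le_source[of v n] trunc_sin_nonneg[of v] by simp

lemma source_pos: "v < 0 \<Longrightarrow> 0 < G n v"
  using trunc_sin_le_source[of v n] trunc_sin_pos[of v] by simp

lemma varpi_seq_pos: "0 < W n" and moment_varpi_seq: "moment (G n) (W n) = 1"
  using step_width_moment[of "\<beta> n"] continuous_on_source trunc_sin_le_beta_seq
  by (simp_all add: source_def[abs_def] varpi_seq_def)

lemma varpi_seq_le: "W n \<le> pi / 2"
  by (rule trunc_sin_le_profile(1)[OF continuous_on_source trunc_sin_le_source varpi_seq_pos moment_varpi_seq])

lemma beta_seq_Suc_eq: "t \<le> 0 \<Longrightarrow> \<beta> (Suc n) t = profile (G n) (W n) t"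
  by (rule beta_seq_Suc_profile[OF continuous_on_source trunc_sin_le_beta_seq])

lemma beta_seq_antitone: "s \<le> t \<Longrightarrow> t \<le> 0 \<Longrightarrow> \<beta> n t \<le> \<beta> n s"
  by (cases n) (simp_all add: beta_seq_Suc_eq profile_antitone[OF continuous_on_source source_nonneg] del: beta_seq.simps(2))

lemma beta_seq_eq_1: "t \<le> - W n \<Longrightarrow> \<beta> (Suc n) t = 1"
  using varpi_seq_pos[of n] by (simp add: beta_seq_Suc_eq profile_eq_moment moment_varpi_seq del: beta_seq.simps(2))

lemma beta_seq_le_1: "t \<le> 0 \<Longrightarrow> \<beta> n t \<le> 1"
proof (cases n)
  case (Suc m)
  assume "t \<le> 0"
  then show ?thesis
    using profile_le_moment[OF continuous_on_source[of m] source_nonneg, of "W m" t] Suc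
    by (simp add: beta_seq_Suc_eq moment_varpi_seq del: beta_seq.simps(2))
qed simp

text \<open>The start is \<open>\<beta> 1 \<le> 1 = \<beta> 0\<close>. After that, a smaller iterate
  gives a smaller source, and the comparison principle gives a smaller next iterate.\<close>

lemma beta_seq_decreasing: "t \<le> 0 \<Longrightarrow> \<beta> (Suc n) t \<le> \<beta> n t"
proof (induction n arbitrary: t)
  case 0
  then show ?case using beta_seq_le_1[of t 1] by simp
next
  case (Suc n)
  have "G (Suc n) v \<le> G n v" if "v \<le> 0" for v
    unfolding source_def using Suc.IH[OF that] by (rule max.mono) simp
  then show ?case
    unfolding beta_seq_Suc_eq[OF Suc.prems]
    by (intro profile_mono(2)[OF continuous_on_source continuous_on_source _ source_pos varpi_seq_pos moment_varpi_seq
          varpi_seq_pos moment_varpi_seq Suc.prems])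
qed

lemma varpi_seq_mono: "W n \<le> W (Suc n)"
proof -
  have "G (Suc n) v \<le> G n v" if "v \<le> 0" for v
    unfolding source_def using beta_seq_decreasing[OF that] by (rule max.mono) simp
  then show ?thesis
    by (intro profile_mono(1)[OF continuous_on_source continuous_on_source _ source_pos varpi_seq_pos moment_varpi_seq
          varpi_seq_pos moment_varpi_seq])
qed

section \<open>Limits of the widths and of the iterates, and the limiting equation\<close>

lemma varpi_seq_LIMSEQ: "W \<longlonglongrightarrow> Psi \<rho> \<Delta>"
proof -
  have "incseq W" using varpi_seq_mono by (rule incseq_SucI)
  then obtain L where "W \<longlonglongrightarrow> L" using incseq_convergent[of W "pi / 2"] varpi_seq_le by blast
  then show ?thesis unfolding Psi_def by (simp add: limI)
qed

lemma varpi_seq_le_Psi: "W n \<le> Psi \<rho> \<Delta>"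
  using varpi_seq_LIMSEQ incseq_le[OF incseq_SucI] varpi_seq_mono by blast

lemma Psi_pos: "0 < Psi \<rho> \<Delta>"
  using varpi_seq_pos[of 0] varpi_seq_le_Psi[of 0] by simp

lemma Psi_le: "Psi \<rho> \<Delta> \<le> pi / 2"
  using varpi_seq_LIMSEQ varpi_seq_le by (intro LIMSEQ_le_const2) auto

text \<open>A bound uniform in \<open>n\<close> on an interval containing every
  \<open>{- W n..0}\<close>; it supplies the common Lipschitz constant and the dominating
  function.\<close>

lemma source_bounded: "\<exists>C\<ge>0. \<forall>n. \<forall>v\<in>{- (pi / 2)..0}. G n v \<le> C"
proof -
  have "compact (forcing \<rho> \<Delta> ` {- (pi / 2)..0})"
    by (intro compact_continuous_image continuous_on_subset[OF continuous_on_forcing[OF \<Delta>]]) auto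
  then have "bounded (forcing \<rho> \<Delta> ` {- (pi / 2)..0})" by (rule compact_imp_bounded)
  then obtain C where "\<forall>x\<in>forcing \<rho> \<Delta> ` {- (pi / 2)..0}. norm x \<le> C" unfolding bounded_iff by blast
  then have C: "\<And>v. v \<in> {- (pi / 2)..0} \<Longrightarrow> forcing \<rho> \<Delta> v \<le> C" by force
  have "G n v \<le> max 1 C" if "v \<in> {- (pi / 2)..0}" for n v
    unfolding source_def using C[OF that] beta_seq_le_1[of v n] that by (intro max.mono) auto
  then show ?thesis by (intro exI[of _ "max 1 C"]) auto
qed

lemma beta_seq_LIMSEQ:
  assumes "t \<le> 0"
  shows "(\<lambda>n. \<beta> n t) \<longlonglongrightarrow> Y t"
proof -
  have "decseq (\<lambda>n. \<beta> n t)" using beta_seq_decreasing[OF assms] by (rule decseq_SucI)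
  then obtain L where "(\<lambda>n. \<beta> n t) \<longlonglongrightarrow> L"
    using decseq_convergent[of "\<lambda>n. \<beta> n t" "trunc_sin t"] trunc_sin_le_beta_seq[OF assms] by blast
  then show ?thesis unfolding beta_lim_def by (simp add: limI)
qed

lemma source_LIMSEQ: "t \<le> 0 \<Longrightarrow> (\<lambda>n. G n t) \<longlonglongrightarrow> H t"
  unfolding source_def source_lim_def by (intro tendsto_max beta_seq_LIMSEQ tendsto_const)

text \<open>The iterates are equi-Lipschitz, so their pointwise limit is continuous.\<close>

lemma continuous_on_beta_lim: "continuous_on {..0} Y"
proof -
  obtain C where C: "C \<ge> 0" "\<And>n v. v \<in> {- (pi / 2)..0} \<Longrightarrow> G n v \<le> C" using source_bounded by blast
  have lip: "\<bar>Y t - Y s\<bar> \<le> pi / 2 * C * (t - s)" if "s \<le> t" "t \<le> 0" for s t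
  proof -
    have "\<bar>\<beta> (Suc n) t - \<beta> (Suc n) s\<bar> \<le> pi / 2 * C * (t - s)" for n
    proof -
      have "\<bar>\<beta> (Suc n) t - \<beta> (Suc n) s\<bar> = profile (G n) (W n) s - profile (G n) (W n) t"
        using that beta_seq_antitone[OF that, of "Suc n"] by (simp add: beta_seq_Suc_eq del: beta_seq.simps(2))
      also have "\<dots> \<le> W n * C * (t - s)"
      proof (rule profile_lipschitz[OF continuous_on_source _ varpi_seq_pos that(1)])
        show "0 \<le> G n v \<and> G n v \<le> C" if "v \<in> {-W n..0}" for v
          using that varpi_seq_le[of n] by (intro conjI source_nonneg C) auto
      qed
      also have "\<dots> \<le> pi / 2 * C * (t - s)"
        using varpi_seq_le[of n] C(1) that by (intro mult_right_mono) auto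
      finally show ?thesis .
    qed
    moreover have "(\<lambda>n. \<bar>\<beta> (Suc n) t - \<beta> (Suc n) s\<bar>) \<longlonglongrightarrow> \<bar>Y t - Y s\<bar>"
      using that by (intro tendsto_rabs tendsto_diff LIMSEQ_Suc beta_seq_LIMSEQ) auto
    ultimately show ?thesis by (intro LIMSEQ_le_const2) auto
  qed
  have "(pi / 2 * C)-lipschitz_on {..0} Y"
  proof (rule lipschitz_onI)
    fix s t :: real assume "s \<in> {..0}" "t \<in> {..0}"
    then show "dist (Y s) (Y t) \<le> pi / 2 * C * dist s t"
      using lip[of s t] lip[of t s] by (cases s t rule: le_cases) (auto simp: dist_real_def abs_minus_commute)
  qed (use C in auto)
  then show ?thesis by (rule lipschitz_on_continuous_on)
qed

lemma continuous_on_source_lim: "continuous_on {..0} H"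
  unfolding source_lim_def[abs_def]
  by (intro continuous_on_max continuous_on_forcing[OF \<Delta>] continuous_on_beta_lim)

text \<open>The interval of integration moves with \<open>n\<close>, so the integrands are extended
  by 0 to the fixed interval \<open>S\<close> before dominated convergence is applied.\<close>

lemma profile_LIMSEQ:
  assumes "t \<le> 0"
  shows "(\<lambda>n. profile (G n) (W n) t) \<longlonglongrightarrow> profile H (Psi \<rho> \<Delta>) t"
proof -
  obtain C where C: "C \<ge> 0" "\<And>n v. v \<in> {- (pi / 2)..0} \<Longrightarrow> G n v \<le> C" using source_bounded by blast
  define S where "S = {- (pi / 2)..0::real}"
  \<comment> \<open>The cutoff omits the end point \<open>-w\<close>, which does not affect the
    integral. With it, the integrands could all vanish at \<open>v = - Psi \<rho> \<Delta>\<close>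
    while the limit integrand does not; without it, convergence holds at every point of
    \<open>S\<close>.\<close>
  define F where "F g w v = (if v \<in> {-w<..0} then min (-t) (-v) * g v else 0)" for g :: "real \<Rightarrow> real" and w v
  have F: "F g w integrable_on S \<and> integral S (F g w) = profile g w t"
    if g: "continuous_on {..0} g" and w: "w \<le> pi / 2" for g w
  proof -
    have int: "(\<lambda>v. min (-t) (-v) * g v) integrable_on {-w..0}" by (rule integrable_kernel[OF g order_refl])
    have sub: "S \<inter> {-w..0} = {-w..0}" "{-w..0} \<inter> S = {-w..0}" using w by (auto simp: S_def)
    have int': "(\<lambda>v. if v \<in> {-w..0} then min (-t) (-v) * g v else 0) integrable_on S"
      using int by (simp only: integrable_restrict_Int sub)
    have eq: "F g w v = (if v \<in> {-w..0} then min (-t) (-v) * g v else 0)" if "v \<in> S - {-w}" for v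
      using that by (auto simp: F_def)
    have "F g w integrable_on S"
      by (rule integrable_spike[OF int' negligible_sing[of "-w"] eq])
    moreover have "integral S (F g w) = integral S (\<lambda>v. if v \<in> {-w..0} then min (-t) (-v) * g v else 0)"
      by (rule integral_spike[OF negligible_sing[of "-w"] eq[symmetric]])
    ultimately show ?thesis by (simp only: integral_restrict_Int sub profile_def)
  qed
  have "(\<lambda>n. integral S (F (G n) (W n))) \<longlonglongrightarrow> integral S (F H (Psi \<rho> \<Delta>))"
  proof (rule dominated_convergence(2))
    show "F (G n) (W n) integrable_on S" for n
      using F[OF continuous_on_source varpi_seq_le] by blast
    show "(\<lambda>v. pi / 2 * C) integrable_on S" unfolding S_def by (rule integrable_const_ivl)
    fix v assume v: "v \<in> S"
    then have v0: "v \<le> 0" by (simp add: S_def)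
    show "norm (F (G n) (W n) v) \<le> pi / 2 * C" for n
    proof -
      have k: "0 \<le> min (-t) (-v)" "min (-t) (-v) \<le> pi / 2" using assms v by (auto simp: S_def)
      have G: "0 \<le> G n v" "G n v \<le> C" using source_nonneg[OF v0] C(2) v by (auto simp: S_def)
      have "0 \<le> min (-t) (-v) * G n v" by (rule mult_nonneg_nonneg[OF k(1) G(1)])
      moreover have "min (-t) (-v) * G n v \<le> pi / 2 * C"
        by (rule mult_mono[OF k(2) G(2) _ G(1)]) simp
      ultimately show ?thesis using C(1) by (auto simp: F_def)
    qed
    show "(\<lambda>n. F (G n) (W n) v) \<longlonglongrightarrow> F H (Psi \<rho> \<Delta>) v"
    proof (cases "v \<in> {- Psi \<rho> \<Delta><..0}")
      case True
      then have "- v < Psi \<rho> \<Delta>" by auto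
      then have "\<forall>\<^sub>F n in sequentially. - v < W n" by (rule order_tendstoD(1)[OF varpi_seq_LIMSEQ])
      then have "\<forall>\<^sub>F n in sequentially. min (-t) (-v) * G n v = F (G n) (W n) v"
        by eventually_elim (use v0 in \<open>auto simp: F_def\<close>)
      moreover have "(\<lambda>n. min (-t) (-v) * G n v) \<longlonglongrightarrow> min (-t) (-v) * H v"
        by (intro tendsto_mult tendsto_const source_LIMSEQ v0)
      ultimately show ?thesis using True Lim_transform_eventually by (auto simp: F_def)
    next
      case False
      then have "v \<notin> {-W n<..0}" for n using varpi_seq_le_Psi[of n] v0 by auto
      then show ?thesis using False by (simp add: F_def del: greaterThanAtMost_iff)
    qed
  qed
  then show ?thesis using F[OF continuous_on_source varpi_seq_le] F[OF continuous_on_source_lim Psi_le] by simp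
qed

lemma beta_lim_eq_profile: "t \<le> 0 \<Longrightarrow> Y t = profile H (Psi \<rho> \<Delta>) t"
  using LIMSEQ_unique[OF LIMSEQ_Suc[OF beta_seq_LIMSEQ[of t]], of "profile H (Psi \<rho> \<Delta>) t"] profile_LIMSEQ[of t]
  by (simp add: beta_seq_Suc_eq del: beta_seq.simps(2))

text \<open>The point \<open>- (pi / 2)\<close> lies to the left of, or at, every
  \<open>- W n\<close> and the limit of these. The profiles there are moments, all equal to
  1.\<close>

lemma moment_Psi: "moment H (Psi \<rho> \<Delta>) = 1"
proof -
  have "(\<lambda>n. profile (G n) (W n) (- (pi / 2))) = (\<lambda>n. 1)"
    using varpi_seq_le by (simp add: profile_eq_moment moment_varpi_seq)
  then have "profile H (Psi \<rho> \<Delta>) (- (pi / 2)) = 1"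
    using profile_LIMSEQ[of "- (pi / 2)"] LIMSEQ_unique[OF _ tendsto_const] by auto
  then show ?thesis using Psi_le by (simp add: profile_eq_moment)
qed

text \<open>Since \<open>H\<close> is continuous, two differentiations of the integral equation give
  the differential equation at every point. Positivity is inherited from the barrier.\<close>

lemma beta_lim_solves_bvp: "solves_bvp \<rho> \<Delta> Y"
  unfolding solves_bvp_def second_deriv_ae_def
proof (intro conjI ballI allI impI exI[of _ "\<lambda>t. - integral {- Psi \<rho> \<Delta>..t} H"] AE_I2)
  let ?P = "Psi \<rho> \<Delta>" and ?d = "\<lambda>t. - integral {- Psi \<rho> \<Delta>..t} H"
  have cont: "continuous_on {-?P..0} H"
    by (rule continuous_on_subset[OF continuous_on_source_lim]) auto
  have d1: "(Y has_real_derivative ?d t) (at t within {-?P..0})" if "t \<in> {-?P..0}" for t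
    by (rule has_field_derivative_transform_within[OF has_real_derivative_profile[OF cont that], of 1])
      (use that in \<open>auto simp: beta_lim_eq_profile\<close>)
  have d2: "(?d has_real_derivative - H t) (at t within {-?P..0})" if "t \<in> {-?P..0}" for t
    by (intro DERIV_minus integral_has_real_derivative cont that)
  have left: "Y t = 1" if "t \<le> - ?P" for t
    using that Psi_pos by (simp add: beta_lim_eq_profile profile_eq_moment moment_Psi)
  show "(Y has_real_derivative ?d t) (at t within {-?P..0})" if "t \<in> {-?P..0}" for t
    by (rule d1[OF that])
  show "\<exists>d. (?d has_real_derivative d) (at t within {-?P..0}) \<and> d + max (Y t) (forcing \<rho> \<Delta> t) = 0"
    if "t \<in> {-?P..0}" for t
    by (intro exI[of _ "- H t"] conjI d2 that) (simp add: source_lim_def)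
  show "abs_continuous_on {-?P..0} Y"
    by (rule abs_continuous_on_C1[OF d1 DERIV_continuous_on[OF d2]])
  show "abs_continuous_on {-?P..0} ?d"
    by (rule abs_continuous_on_C1[OF d2 continuous_on_minus[OF cont]])
  show "Y 0 = 0" by (simp add: beta_lim_eq_profile profile_0)
  show "0 < Y t" if "t \<in> {-?P..<0}" for t
  proof -
    have "t \<le> 0" using that by simp
    then have "trunc_sin t \<le> Y t"
      using trunc_sin_le_beta_seq by (intro LIMSEQ_le_const[OF beta_seq_LIMSEQ]) auto
    then show ?thesis using trunc_sin_pos[of t] that by simp
  qed
  show "Y t = 1" if "t \<le> - ?P" for t by (rule left[OF that])
  \<comment> \<open>The constant continuation on the left and the empty integral on the right both
    give slope 0, and the two one-sided derivatives are glued.\<close>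
  have "(Y has_real_derivative 0) (at (-?P) within {..-?P})"
    by (rule has_field_derivative_transform_within[of "\<lambda>t. 1" _ _ _ 1]) (use left in auto)
  moreover have "(Y has_real_derivative 0) (at (-?P) within {-?P..0})"
    using d1[of "-?P"] Psi_pos by simp
  ultimately have "(Y has_real_derivative 0) (at (-?P) within ({..-?P} \<union> {-?P..0}))"
    by (rule has_field_derivative_Un)
  moreover have "at (-?P) within ({..-?P} \<union> {-?P..0}) = at (-?P)"
    by (rule at_within_nhd[of _ "{..<0}" _ UNIV, simplified]) (use Psi_pos in auto)
  ultimately show "(Y has_real_derivative 0) (at (-?P))" by simp
qed

section \<open>Comparison with subsolutions\<close>

lemma concave_nonneg_on_interval:
  assumes "a < b" and d: "\<And>t. t \<in> {a..b} \<Longrightarrow> (h has_real_derivative h' t) (at t within {a..b})"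
    and anti: "\<And>s t. a \<le> s \<Longrightarrow> s \<le> t \<Longrightarrow> t \<le> b \<Longrightarrow> h' t \<le> h' s"
    and ends: "0 \<le> h a" "0 \<le> h b" and t: "t \<in> {a..b}"
  shows "0 \<le> (h t :: real)"
proof (rule ccontr)
  assume neg: "\<not> 0 \<le> h t"
  then have "a < t" "t < b" using ends t by (auto simp: less_le)
  obtain \<xi> where \<xi>: "a < \<xi>" "\<xi> < t" "h t - h a = h' \<xi> * (t - a)"
    using mvt_within_real[OF \<open>a < t\<close> _ d] t by (metis atLeastatMost_subset_iff atLeastAtMost_iff order_refl)
  obtain \<eta> where \<eta>: "t < \<eta>" "\<eta> < b" "h b - h t = h' \<eta> * (b - t)"
    using mvt_within_real[OF \<open>t < b\<close> _ d] t by (metis atLeastatMost_subset_iff atLeastAtMost_iff order_refl)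
  \<comment> \<open>A negative value between nonnegative ends forces a falling slope first and a
    rising one later, against the monotonicity of \<open>h'\<close>.\<close>
  have "h' \<xi> < 0" using \<xi> neg ends \<open>a < t\<close> by (smt (verit) zero_le_mult_iff)
  moreover have "0 < h' \<eta>" using \<eta> neg ends \<open>t < b\<close> by (smt (verit) mult_nonpos_nonneg)
  moreover have "h' \<eta> \<le> h' \<xi>" using \<xi> \<eta> t by (intro anti) auto
  ultimately show False by simp
qed

text \<open>To the left of \<open>- W n\<close> the next iterate is 1 and dominates \<open>x\<close>
  trivially. To the right, \<open>x''\<close> is known only almost everywhere, so concavity of the
  difference is expressed by its derivative being nonincreasing, which absolute continuity
  provides.\<close>

lemma subsolution_le_beta_seq:
  assumes x1: "\<And>w. w \<in> {- Psi \<rho> \<Delta>..0} \<Longrightarrow> x w \<le> 1" and x0: "x 0 = 0"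
    and x: "second_deriv_ae {- Psi \<rho> \<Delta>..0} x
      (\<lambda>w d. d + max (SUP t\<in>{w..0}. x t) (forcing \<rho> \<Delta> w) \<ge> 0)"
  shows "w \<in> {- Psi \<rho> \<Delta>..0} \<Longrightarrow> x w \<le> \<beta> n w"
proof (induction n arbitrary: w)
  case 0
  then show ?case using x1 by simp
next
  case (Suc n)
  let ?P = "Psi \<rho> \<Delta>" and ?w = "W n"
  show ?case
  proof (cases "w \<le> - ?w")
    case True
    then show ?thesis using beta_seq_eq_1[of w n] x1[OF Suc.prems] by simp
  next
    case False
    obtain x' where x': "\<And>t. t \<in> {-?P..0} \<Longrightarrow> (x has_real_derivative x' t) (at t within {-?P..0})"
      and ac: "abs_continuous_on {-?P..0} x'"
      and ae: "AE t\<in>{-?P..0} in lebesgue. \<exists>d. (x' has_real_derivative d) (at t within {-?P..0}) \<and>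
        d + max (SUP t\<in>{t..0}. x t) (forcing \<rho> \<Delta> t) \<ge> 0"
      using x unfolding second_deriv_ae_def by blast
    have sub: "{-?w..0} \<subseteq> {-?P..0}" using varpi_seq_le_Psi[of n] by auto
    have cont: "continuous_on {-?w..0} (G n)" by (rule continuous_on_subset[OF continuous_on_source]) auto
    let ?I = "\<lambda>t. integral {-?w..t} (G n)"
    have I: "(?I has_real_derivative G n t) (at t within {-?w..0})" if "t \<in> {-?w..0}" for t
      by (rule integral_has_real_derivative[OF cont that])
    have "0 \<le> profile (G n) ?w w + - x w"
    proof (rule concave_nonneg_on_interval[where h="\<lambda>t. profile (G n) ?w t + - x t"
            and h'="\<lambda>t. - ?I t + - x' t" and a="-?w" and b=0])
      show "((\<lambda>t. profile (G n) ?w t + - x t) has_real_derivative - ?I t + - x' t) (at t within {-?w..0})"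
        if "t \<in> {-?w..0}" for t
        using that sub by (intro DERIV_add DERIV_minus has_real_derivative_profile cont DERIV_subset[OF x']) auto
      show "- ?I t + - x' t \<le> - ?I s + - x' s" if st: "-?w \<le> s" "s \<le> t" "t \<le> 0" for s t
      proof -
        \<comment> \<open>Almost everywhere this function has derivative \<open>G n + x''\<close>,
          which is nonnegative by the subsolution inequality and the induction hypothesis.\<close>
        have "?I s + x' s \<le> ?I t + x' t"
        proof (rule abs_continuous_nonneg_deriv_AE_le[OF _ st(2)])
          have "abs_continuous_on {-?w..0} ?I" by (rule abs_continuous_on_C1[OF I cont])
          then show "abs_continuous_on_interval s t (\<lambda>t. ?I t + x' t)"
            using ac st sub unfolding abs_continuous_on_def
            by (intro abs_continuous_on_interval_add) auto
          show "AE v\<in>{s..t} in lebesgue. \<exists>d\<ge>0. ((\<lambda>t. ?I t + x' t) has_real_derivative d) (at v within {s..t})"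
            using ae
          proof (rule AE_mp, intro AE_I2 impI)
            fix v assume 1: "v \<in> {-?P..0} \<longrightarrow> (\<exists>d. (x' has_real_derivative d) (at v within {-?P..0}) \<and>
              d + max (SUP t\<in>{v..0}. x t) (forcing \<rho> \<Delta> v) \<ge> 0)" and v: "v \<in> {s..t}"
            have v': "v \<in> {-?w..0}" "v \<in> {-?P..0}" "{s..t} \<subseteq> {-?w..0}" using v st sub by auto
            then obtain d where d: "(x' has_real_derivative d) (at v within {-?P..0})"
              "d + max (SUP t\<in>{v..0}. x t) (forcing \<rho> \<Delta> v) \<ge> 0" using 1 by blast
            \<comment> \<open>The induction hypothesis is used on all of \<open>{v..0}\<close>;
              monotonicity of \<open>\<beta> n\<close> moves every bound to
              \<open>v\<close>.\<close>
            have "(SUP t\<in>{v..0}. x t) \<le> \<beta> n v"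
            proof (rule cSUP_least)
              fix r assume r: "r \<in> {v..0}"
              then have "x r \<le> \<beta> n r" using v'(2) by (intro Suc.IH) auto
              also have "\<dots> \<le> \<beta> n v" using r by (intro beta_seq_antitone) auto
              finally show "x r \<le> \<beta> n v" .
            qed (use v' in auto)
            then have "max (SUP t\<in>{v..0}. x t) (forcing \<rho> \<Delta> v) \<le> G n v"
              unfolding source_def by (rule max.mono) simp
            then have "0 \<le> G n v + d" using d(2) by linarith
            moreover have "((\<lambda>t. ?I t + x' t) has_real_derivative G n v + d) (at v within {s..t})"
              using v' sub by (intro DERIV_add DERIV_subset[OF I] DERIV_subset[OF d(1)]) auto
            ultimately show "\<exists>d\<ge>0. ((\<lambda>t. ?I t + x' t) has_real_derivative d) (at v within {s..t})" by blast
          qed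
        qed
        then show ?thesis by simp
      qed
      \<comment> \<open>At the left end the profile equals its moment, which is 1.\<close>
      show "0 \<le> profile (G n) ?w (-?w) + - x (-?w)"
        using x1[of "-?w"] sub varpi_seq_pos[of n] by (simp add: profile_eq_moment moment_varpi_seq)
      show "0 \<le> profile (G n) ?w 0 + - x 0" by (simp add: profile_0 x0)
    qed (use varpi_seq_pos[of n] False Suc.prems in auto)
    then show ?thesis using Suc.prems by (simp add: beta_seq_Suc_eq del: beta_seq.simps(2))
  qed
qed

end

theorem theorem10:
  fixes \<Delta> \<rho> :: real
  assumes "0 \<le> \<Delta>" and "0 < \<rho>"
  shows "Psi \<rho> \<Delta> \<le> pi / 2 \<and>
    (\<exists>y. (\<forall>t\<le>0. (\<lambda>n. beta_seq \<rho> \<Delta> n t) \<longlonglongrightarrow> y t) \<and>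
         solves_bvp \<rho> \<Delta> y \<and>
         (\<forall>x. (\<forall>w\<in>{- Psi \<rho> \<Delta>..0}. 0 \<le> x w) \<and> x 0 = 0 \<and>
              (SUP t\<in>{- Psi \<rho> \<Delta>..0}. x t) \<le> 1 \<and>
              second_deriv_ae {- Psi \<rho> \<Delta>..0} x
                (\<lambda>w d. d + max (SUP t\<in>{w..0}. x t) (forcing \<rho> \<Delta> w) \<ge> 0)
            \<longrightarrow> (\<forall>w\<in>{- Psi \<rho> \<Delta>..0}. x w \<le> y w)))"
proof (intro conjI exI[of _ "beta_lim \<rho> \<Delta>"] allI impI ballI)
  note \<Delta> = \<open>0 \<le> \<Delta>\<close>
  show "Psi \<rho> \<Delta> \<le> pi / 2" by (rule Psi_le[OF \<Delta>])
  show "(\<lambda>n. beta_seq \<rho> \<Delta> n t) \<longlonglongrightarrow> beta_lim \<rho> \<Delta> t" if "t \<le> 0" for t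
    by (rule beta_seq_LIMSEQ[OF \<Delta> that])
  show "solves_bvp \<rho> \<Delta> (beta_lim \<rho> \<Delta>)" by (rule beta_lim_solves_bvp[OF \<Delta>])
  fix x w
  assume x: "(\<forall>w\<in>{- Psi \<rho> \<Delta>..0}. 0 \<le> x w) \<and> x 0 = 0 \<and>
              (SUP t\<in>{- Psi \<rho> \<Delta>..0}. x t) \<le> 1 \<and>
              second_deriv_ae {- Psi \<rho> \<Delta>..0} x
                (\<lambda>w d. d + max (SUP t\<in>{w..0}. x t) (forcing \<rho> \<Delta> w) \<ge> 0)"
    and w: "w \<in> {- Psi \<rho> \<Delta>..0}"
  then obtain x' where "\<And>t. t \<in> {- Psi \<rho> \<Delta>..0} \<Longrightarrow> (x has_real_derivative x' t) (at t within {- Psi \<rho> \<Delta>..0})"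
    unfolding second_deriv_ae_def by blast
  \<comment> \<open>A real \<open>SUP\<close> bounds the values only when the set is bounded above;
    continuity on a compact interval ensures this and yields \<open>x t \<le> 1\<close>
    pointwise.\<close>
  then have "continuous_on {- Psi \<rho> \<Delta>..0} x" by (rule DERIV_continuous_on)
  then have "bdd_above (x ` {- Psi \<rho> \<Delta>..0})"
    by (intro bounded_imp_bdd_above compact_imp_bounded compact_continuous_image) auto
  then have "x t \<le> 1" if "t \<in> {- Psi \<rho> \<Delta>..0}" for t
    using cSUP_upper[OF that] x by (meson order_trans)
  then have "x w \<le> beta_seq \<rho> \<Delta> n w" for n
    using x w by (intro subsolution_le_beta_seq[OF \<Delta>]) auto
  then show "x w \<le> beta_lim \<rho> \<Delta> w"
    using w by (intro LIMSEQ_le_const[OF beta_seq_LIMSEQ[OF \<Delta>]]) auto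
qed

end
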